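(* Let $\lambda\in(0,1/2)$, $0<\alpha\le\beta<1/2$ with $\alpha+\beta=2\lambda$, and $k_0,K_0>0$. There exist positive constants $M$ and $m$, depending only on $\lambda,\alpha,k_0,K_0$, such that the following holds. Let $K$ be an admissible kernel with parameters $(\lambda,\alpha,\beta,k_0,K_0)$, let $h_\lambda$ be the associated constant, and let $h:(0,\infty)\to(0,\infty)$ be a (measurable) positive function satisfying, for almost all $x\in(0,\infty)$, $$h(x)=h_\lambda\,x^{2\lambda-1}\int_0^x y^{-2\lambda}h(y)\int_{x-y}^\infty K(y,z)\,z^{-(1+2\lambda)}h(z)\,dz\,dy .$$ Then $$\sup_{x\in(0,\infty)}h(x)\le M\qquad\text{and}\qquad \liminf_{x\to0}h(x)\ge m,$$ where $\sup$ and $\liminf$ are understood in the essential sense, i.e. up to Lebesgue-null sets: $h(x)\le M$ for almost every $x\in(0,\infty)$, and $\lim_{r\to0^+}\operatorname{ess\,inf}_{x\in(0,r)}h(x)\ge m$.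
   Context: Write $\mathbb{R}_+=(0,\infty)$. A function $K:\mathbb{R}_+^2\to[0,\infty)$ is called here an admissible kernel with parameters $(\lambda,\alpha,\beta,k_0,K_0)$ if: (i) $K\in C^1(\mathbb{R}_+^2)$ and $K$ is symmetric, $K(x,y)=K(y,x)$; (ii) $K$ is homogeneous of degree $2\lambda\in(0,1)$: $K(ax,ay)=a^{2\lambda}K(x,y)$ for all $a,x,y>0$; (iii) $K(x,y)\le K_0\,(x^\alpha y^\beta+x^\beta y^\alpha)$ for all $x,y>0$, where $0<\alpha\le\beta<1/2$ and $\alpha+\beta=2\lambda$; (iv) $\min_{[1/4,1]\times[1/4,1]}K(x,y)\ge k_0$. The constant $h_\lambda\in(0,\infty)$ associated with $K$ is defined by $$h_\lambda^{-1}=\int_0^1 s^{-2\lambda}\int_{1-s}^\infty K(s,t)\,t^{-(1+2\lambda)}\,dt\,ds ,$$ which is finite and positive under these assumptions. *)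

theory Defs
  imports "HOL-Analysis.Analysis"
begin

definition continuously_differentiable_on ::
    "('a::real_normed_vector \<Rightarrow> 'b::real_normed_vector) \<Rightarrow> 'a set \<Rightarrow> bool" where
  "continuously_differentiable_on f S \<longleftrightarrow>
     (\<exists>f' :: 'a \<Rightarrow> 'a \<Rightarrow>\<^sub>L 'b.
        (\<forall>p\<in>S. (f has_derivative blinfun_apply (f' p)) (at p)) \<and> continuous_on S f')"

text \<open>Kernels and profiles on the open half-line are total functions on the reals; only their
  values at positive arguments are ever constrained or used.\<close>

definition admissible_kernel ::
    "real \<Rightarrow> real \<Rightarrow> real \<Rightarrow> real \<Rightarrow> real \<Rightarrow> (real \<Rightarrow> real \<Rightarrow> real) \<Rightarrow> bool" where
  "admissible_kernel lam \<alpha> \<beta> k0 K0 K \<longleftrightarrow>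
     0 < 2 * lam \<and> 2 * lam < 1 \<and>
     0 < \<alpha> \<and> \<alpha> \<le> \<beta> \<and> \<beta> < 1/2 \<and> \<alpha> + \<beta> = 2 * lam \<and>
     (\<forall>x>0. \<forall>y>0. 0 \<le> K x y) \<and>
     continuously_differentiable_on (\<lambda>(x, y). K x y) ({0<..} \<times> {0<..}) \<and>
     (\<forall>x>0. \<forall>y>0. K x y = K y x) \<and>
     (\<forall>a>0. \<forall>x>0. \<forall>y>0. K (a * x) (a * y) = a powr (2 * lam) * K x y) \<and>
     (\<forall>x>0. \<forall>y>0. K x y \<le> K0 * (x powr \<alpha> * y powr \<beta> + x powr \<beta> * y powr \<alpha>)) \<and>
     (\<forall>x\<in>{1/4..1}. \<forall>y\<in>{1/4..1}. k0 \<le> K x y)"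

text \<open>All integrands are nonnegative, so integrals are taken with values in \<open>[0, \<infinity>]\<close>; a divergent
  integral is then really infinite, not the default value 0 of the Bochner integral.
  For an admissible kernel with \<open>k0 > 0\<close> the integral below is finite and positive.\<close>

definition h_const :: "real \<Rightarrow> (real \<Rightarrow> real \<Rightarrow> real) \<Rightarrow> real" where
  "h_const lam K = inverse (enn2real
     (\<integral>\<^sup>+ s\<in>{0<..<1}. ennreal (s powr (- (2 * lam))) *
        (\<integral>\<^sup>+ t\<in>{1 - s<..}. ennreal (K s t * t powr (- (1 + 2 * lam))) \<partial>lebesgue) \<partial>lebesgue))"

definition profile_equation ::
    "real \<Rightarrow> (real \<Rightarrow> real \<Rightarrow> real) \<Rightarrow> (real \<Rightarrow> real) \<Rightarrow> real \<Rightarrow> bool" where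
  "profile_equation lam K h x \<longleftrightarrow>
     ennreal (h x) =
       ennreal (h_const lam K * x powr (2 * lam - 1)) *
       (\<integral>\<^sup>+ y\<in>{0<..<x}. ennreal (y powr (- (2 * lam)) * h y) *
          (\<integral>\<^sup>+ z\<in>{x - y<..}. ennreal (K y z * z powr (- (1 + 2 * lam)) * h z) \<partial>lebesgue) \<partial>lebesgue)"

definition essinf :: "'a measure \<Rightarrow> ('a \<Rightarrow> ereal) \<Rightarrow> ereal" where
  "essinf M f = Sup {c. AE x in M. c \<le> f x}"

end

theory Submission
  imports Defs
begin

text \<open>The profile equation says, up to constants, that \<open>h\<close> is a quadratic average of itself: sizes
  \<open>y < x\<close> are carried past \<open>x\<close> by sizes \<open>z > x - y\<close>. Two one-sided consequences carry the proof
  (locale \<open>profile_bounds\<close>). Restricting to comparable sizes gives, for \<open>R/2 < x < R\<close>,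
  \<open>h x \<ge> c / R^2 * mass (R/2, x) * mass (R/2, 2 R)\<close>. The growth condition on the kernel bounds
  \<open>h x\<close> by a convolution of \<open>h\<close> with a kernel of singularity \<open>\<beta> < 1/2\<close>, weighted by the tail
  rate \<open>T\<close>, where \<open>T w\<close> is the scale-invariant integral of \<open>h z * z powr (-1 - \<alpha>)\<close> over
  \<open>z > w\<close>. Since \<open>h_const\<close> is bounded above and below in terms of \<open>\<alpha>, \<lambda>, k0, K0\<close>, the
  constants are uniform.

  Upper bound. The lower inequality is integrated over \<open>(3/4 R, R)\<close>; the common factor
  \<open>mass (R/2, 2 R)\<close> cancels and the averages of \<open>h\<close> are bounded (\<open>mass_octave\<close>). Then the
  tail rate is bounded, and two applications of the convolution turn bounded averages into a
  pointwise bound (\<open>bounded\<close>); this is where \<open>\<beta> < 1/2\<close> enters.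

  Lower bound. A small value of \<open>h\<close> at \<open>x\<close> forces small averages, hence small values, on a long
  interval to the left of \<open>x\<close> (\<open>small_value_small_average\<close>, \<open>small_average_small_nearby\<close>).
  Smallness on a sufficiently long interval \<open>(a, N a)\<close> persists on \<open>(a, \<infinity>)\<close>
  (\<open>small_forever\<close>): where \<open>h\<close> is small for a while, the tail rate is small and \<open>h\<close> decays like a
  power (\<open>decay\<close>), whereas afterwards it can grow only by a bounded factor on a bounded range of
  scales (\<open>growth\<close>), so it cannot return to the original level. If small values occurred
  arbitrarily close to 0, \<open>h\<close> would thus be small on the whole half-line; but then the convolution
  inequality is a contraction and \<open>h = 0\<close> (\<open>not_small_everywhere\<close>), contrary to positivity.\<close>

section \<open>Power integrals\<close>

lemma Beta_nonneg_real: "0 < a \<Longrightarrow> 0 < b \<Longrightarrow> 0 \<le> Beta a (b::real)"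
  by (simp add: Beta_def Gamma_real_pos order_less_imp_le)

lemma nn_integral_linear_combination:
  assumes [measurable]: "f \<in> borel_measurable N" "g \<in> borel_measurable N"
  shows "(\<integral>\<^sup>+z. a * f z + b * g z \<partial>N) = a * (\<integral>\<^sup>+z. f z \<partial>N) + b * (\<integral>\<^sup>+z. g z \<partial>N)"
  by (simp add: nn_integral_add nn_integral_cmult)

lemma set_nn_integral_powr_head:
  assumes "p < 1" "0 < x"
  shows "(\<integral>\<^sup>+y\<in>{0<..<x}. ennreal (y powr (-p)) \<partial>lborel) = ennreal (x powr (1 - p) / (1 - p))"
proof (rule nn_integral_has_integral_lebesgue')
  show "((\<lambda>y. y powr (-p)) has_integral x powr (1 - p) / (1 - p)) {0<..<x}"
    using has_integral_powr_from_0[of "-p" x] assms by (simp add: has_integral_Icc_iff_Ioo)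
qed auto

lemma set_nn_integral_powr_tail:
  assumes "0 < p" "0 < w"
  shows "(\<integral>\<^sup>+z\<in>{w<..}. ennreal (z powr (-1 - p)) \<partial>lborel) = ennreal (w powr (-p) / p)"
proof -
  have "(\<integral>\<^sup>+z\<in>{w<..}. ennreal (z powr (-1 - p)) \<partial>lborel)
      = (\<integral>\<^sup>+z\<in>{w..}. ennreal (z powr (-1 - p)) \<partial>lborel)"
    by (intro nn_integral_cong_AE eventually_mono[OF AE_lborel_singleton[of w]])
      (auto simp: indicator_def)
  also have "\<dots> = ennreal (w powr (-p) / p)"
    using has_integral_powr_to_inf[of "-1 - p" w] assms
    by (intro nn_integral_has_integral_lebesgue') auto
  finally show ?thesis .
qed

text \<open>The Beta integral on a general interval; it controls all the weakly singular convolutions below.\<close>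
lemma set_nn_integral_powr_conv:
  assumes "p < 1" "r < 1" "u < v"
  shows "(\<integral>\<^sup>+y\<in>{u<..<v}. ennreal ((y - u) powr (-p) * (v - y) powr (-r)) \<partial>lborel)
       = ennreal ((v - u) powr (1 - p - r) * Beta (1 - p) (1 - r))"
proof -
  define d where "d = v - u"
  have d: "0 < d" using assms by (simp add: d_def)
  have B: "(\<integral>\<^sup>+t\<in>{0<..<1}. ennreal (t powr (-p) * (1 - t) powr (-r)) \<partial>lborel)
      = ennreal (Beta (1 - p) (1 - r))"
    using has_integral_Beta_real[of "1 - p" "1 - r"] assms
    by (intro nn_integral_has_integral_lebesgue') (auto simp: has_integral_Icc_iff_Ioo)
  have "(\<integral>\<^sup>+y\<in>{u<..<v}. ennreal ((y - u) powr (-p) * (v - y) powr (-r)) \<partial>lborel)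
      = ennreal \<bar>d\<bar> * (\<integral>\<^sup>+t. ennreal ((u + d * t - u) powr (-p) * (v - (u + d * t)) powr (-r))
            * indicator {u<..<v} (u + d * t) \<partial>lborel)"
    using d by (intro nn_integral_real_affine) auto
  also have "(\<integral>\<^sup>+t. ennreal ((u + d * t - u) powr (-p) * (v - (u + d * t)) powr (-r))
            * indicator {u<..<v} (u + d * t) \<partial>lborel)
      = (\<integral>\<^sup>+t. ennreal (d powr (-p - r)) * (ennreal (t powr (-p) * (1 - t) powr (-r))
            * indicator {0<..<1} t) \<partial>lborel)"
  proof (rule nn_integral_cong)
    fix t :: real
    have *: "u + d * t \<in> {u<..<v} \<longleftrightarrow> t \<in> {0<..<1}"
    proof -
      have "u + d * t < v \<longleftrightarrow> d * t < d * 1" by (auto simp: d_def)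
      then show ?thesis using d by (auto simp: zero_less_mult_iff)
    qed
    have **: "v - (u + d * t) = d * (1 - t)" by (simp add: d_def algebra_simps)
    show "ennreal ((u + d * t - u) powr (-p) * (v - (u + d * t)) powr (-r)) * indicator {u<..<v} (u + d * t)
       = ennreal (d powr (-p - r)) * (ennreal (t powr (-p) * (1 - t) powr (-r)) * indicator {0<..<1} t)"
    proof (cases "t \<in> {0<..<1}")
      case True
      then have "(u + d * t - u) powr (-p) * (v - (u + d * t)) powr (-r)
         = d powr (-p - r) * (t powr (-p) * (1 - t) powr (-r))"
      proof -
        have "u + d * t - u = d * t" by simp
        moreover have "(d * t) powr (-p) = d powr (-p) * t powr (-p)"
          "(d * (1 - t)) powr (-r) = d powr (-r) * (1 - t) powr (-r)"
          using d True by (auto intro!: powr_mult)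
        moreover have "d powr (-p - r) = d powr (-p) * d powr (-r)"
          using powr_add[of d "-p" "-r"] by simp
        ultimately show ?thesis unfolding ** by (simp only: mult_ac)
      qed
      then show ?thesis using True * by (simp add: ennreal_mult')
    qed (use * in auto)
  qed
  also have "\<dots> = ennreal (d powr (-p - r)) * ennreal (Beta (1 - p) (1 - r))"
    using B by (subst nn_integral_cmult) auto
  also have "ennreal \<bar>d\<bar> * \<dots> = ennreal (d powr (1 - p - r) * Beta (1 - p) (1 - r))"
  proof -
    have "d * d powr (-p - r) = d powr (1 - p - r)"
      using d powr_add[of d 1 "-p - r"] by (simp add: add_diff_eq)
    moreover have "Beta (1 - p) (1 - r) \<ge> 0"
      using assms by (intro Beta_nonneg_real) auto
    ultimately show ?thesis using d
      by (simp add: ennreal_mult'[symmetric] mult.assoc[symmetric])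
  qed
  finally show ?thesis by (simp add: d_def)
qed

text \<open>A high power of the variable makes the Beta integral small. With \<open>q = b + Q\<close> the bound is
  \<open>y powr Q \<le> exp (- Q * (1 - y)) \<le> (Q * (1 - y)) powr (-1/2)\<close>, and the resulting extra half
  power of \<open>1 - y\<close> is still integrable because \<open>b < 1/2\<close>.\<close>
lemma Beta_shift_small:
  assumes "0 < b" "b < 1/2" "0 < e"
  shows "\<exists>q>0. Beta (1 - b + q) (1 - b) \<le> (e :: real)"
proof -
  define B where "B = Beta 1 (1/2 - b)"
  have B: "0 \<le> B" unfolding B_def using assms by (intro Beta_nonneg_real) auto
  define Q where "Q = (1 + B / e)\<^sup>2"
  have Q: "0 < Q" "B * Q powr (-(1/2)) \<le> e"
  proof -
    have *: "0 < 1 + B / e" using B assms by (simp add: add_pos_nonneg)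
    then show "0 < Q" by (simp add: Q_def)
    have "Q powr (-(1/2)) = inverse (1 + B / e)"
      using * by (simp add: Q_def powr_minus powr_half_sqrt)
    moreover have "B \<le> e * (1 + B / e)" using assms by (simp add: distrib_left)
    then have "B / (1 + B / e) \<le> e" using * by (subst pos_divide_le_eq)
    ultimately show "B * Q powr (-(1/2)) \<le> e" by (simp only: divide_inverse)
  qed
  have "ennreal (Beta (1 - b + (b + Q)) (1 - b))
      = (\<integral>\<^sup>+y\<in>{0<..<1}. ennreal ((y - 0) powr (-(-Q)) * (1 - y) powr (-b)) \<partial>lborel)"
    using set_nn_integral_powr_conv[of "-Q" b 0 1] assms Q by simp
  also have "\<dots> \<le> (\<integral>\<^sup>+y. ennreal (Q powr (-(1/2))) * (ennreal ((y - 0) powr (-0) * (1 - y) powr (-(b + 1/2))) * indicator {0<..<1} y) \<partial>lborel)"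
  proof (rule nn_integral_mono)
    fix y :: real
    show "ennreal ((y - 0) powr (-(-Q)) * (1 - y) powr (-b)) * indicator {0<..<1} y
      \<le> ennreal (Q powr (-(1/2))) * (ennreal ((y - 0) powr (-0) * (1 - y) powr (-(b + 1/2))) * indicator {0<..<1} y)"
    proof (cases "y \<in> {0<..<1}")
      case True
      define u where "u = Q * (1 - y)"
      have u: "0 < u" using Q True by (simp add: u_def)
      have "y powr Q = exp (Q * ln y)" using True by (simp add: powr_def)
      also have "\<dots> \<le> exp (- u)"
        using ln_le_minus_one[of y] True Q mult_left_mono[of "ln y" "y - 1" Q]
        by (simp add: u_def algebra_simps)
      also have "\<dots> \<le> u powr (-(1/2))"
      proof -
        have "sqrt u \<le> 1 + u" using u by (intro real_le_lsqrt) (auto simp: power2_eq_square algebra_simps)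
        also have "\<dots> \<le> exp u" by (rule exp_ge_add_one_self)
        finally show ?thesis using u by (simp add: exp_minus powr_minus powr_half_sqrt)
      qed
      also have "\<dots> = Q powr (-(1/2)) * (1 - y) powr (-(1/2))"
        unfolding u_def by (rule powr_mult)
      finally have "y powr Q * (1 - y) powr (-b) \<le> (Q powr (-(1/2)) * (1 - y) powr (-(1/2))) * (1 - y) powr (-b)"
        by (intro mult_right_mono) auto
      also have "\<dots> = Q powr (-(1/2)) * (1 - y) powr (-(b + 1/2))"
      proof -
        have "(1 - y) powr (-(1/2)) * (1 - y) powr (-b) = (1 - y) powr (-(b + 1/2))"
          by (simp add: powr_add[symmetric] algebra_simps)
        then show ?thesis by (simp only: mult.assoc)
      qed
      finally show ?thesis using True by (simp add: ennreal_mult'[symmetric] ennreal_leI)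
    qed auto
  qed
  also have "\<dots> = ennreal (Q powr (-(1/2))) * ennreal B"
    using set_nn_integral_powr_conv[of 0 "b + 1/2" 0 1] assms
    by (subst nn_integral_cmult) (auto simp: B_def)
  also have "\<dots> \<le> ennreal e"
    using Q B by (simp add: ennreal_mult'[symmetric] ennreal_leI mult.commute)
  finally have "Beta (1 - b + (b + Q)) (1 - b) \<le> e"
    using assms by (simp add: ennreal_le_iff)
  then show ?thesis using assms Q by (intro exI[of _ "b + Q"]) auto
qed

section \<open>The two inequalities\<close>

text \<open>The integral of \<open>H\<close> over an interval. Profiles are taken with values in \<open>[0, \<infinity>]\<close>, so that no
  integrability has to be known in advance.\<close>
definition mass :: "(real \<Rightarrow> ennreal) \<Rightarrow> real \<Rightarrow> real \<Rightarrow> ennreal" where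
  "mass H a b = (\<integral>\<^sup>+z\<in>{a<..<b}. H z \<partial>lborel)"

text \<open>The scale-invariant tail of \<open>H\<close> beyond \<open>w\<close>: it is \<open>1/\<alpha>\<close> if \<open>H\<close> is constantly 1.
  Up to powers of \<open>y\<close> it bounds the rate at which size \<open>y\<close> is carried past \<open>y + w\<close>.\<close>
definition tail_rate :: "real \<Rightarrow> (real \<Rightarrow> ennreal) \<Rightarrow> real \<Rightarrow> ennreal" where
  "tail_rate \<alpha> H w = ennreal (w powr \<alpha>) * (\<integral>\<^sup>+z\<in>{w<..}. ennreal (z powr (-1 - \<alpha>)) * H z \<partial>lborel)"

text \<open>The only two consequences of the profile equation that are used. The lower bound keeps only
  pairs of comparable sizes, where the kernel is bounded below; the upper bound comes from the
  growth condition on the kernel. Kernel and homogeneity no longer occur; everything that follows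
  is invariant under the scaling \<open>H (a * x)\<close>, and the bounds obtained for \<open>H\<close> depend on
  \<open>\<alpha>, \<beta>, c, C\<close> only.\<close>
locale profile_bounds =
  fixes \<alpha> \<beta> c C :: real and H :: "real \<Rightarrow> ennreal"
  assumes exponents: "0 < \<alpha>" "\<alpha> \<le> \<beta>" "\<beta> < 1/2"
    and constants: "0 < c" "0 < C"
    and measurable_H [measurable]: "H \<in> borel_measurable borel"
    and positive: "AE x in lborel. 0 < x \<longrightarrow> 0 < H x"
    and finite_ae: "AE x in lborel. 0 < x \<longrightarrow> H x < \<infinity>"
    and lower: "AE x in lborel. \<forall>R. 0 < x \<longrightarrow> R / 2 < x \<longrightarrow> x < R \<longrightarrow>
      ennreal (c / R\<^sup>2) * (mass H (R/2) x * mass H (R/2) (2 * R)) \<le> H x"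
    and upper: "AE x in lborel. 0 < x \<longrightarrow> H x \<le> ennreal (C * x powr (2 * \<beta> - 1)) *
      (\<integral>\<^sup>+y\<in>{0<..<x}. ennreal (y powr (-\<beta>) * (x - y) powr (-\<beta>)) * (tail_rate \<alpha> H (x - y) * H y) \<partial>lborel)"

lemma mass_mono: "a' \<le> a \<Longrightarrow> b \<le> b' \<Longrightarrow> mass H a b \<le> mass H a' b'"
  unfolding mass_def by (intro nn_integral_mono mult_left_mono) (auto simp: indicator_def)

lemma mass_subadditive:
  assumes [measurable]: "H \<in> borel_measurable borel"
  shows "mass H a d \<le> mass H a b + mass H b d"
proof -
  have "mass H a d \<le> (\<integral>\<^sup>+z. H z * indicator {a<..<b} z + H z * indicator {b<..<d} z \<partial>lborel)"
    unfolding mass_def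
    by (intro nn_integral_mono_AE eventually_mono[OF AE_lborel_singleton[of b]]) (auto simp: indicator_def)
  then show ?thesis unfolding mass_def by (subst (asm) nn_integral_add) auto
qed

lemma mass_ge:
  assumes [measurable]: "H \<in> borel_measurable borel" and "a \<le> b"
    and "AE x in lborel. a < x \<longrightarrow> x < b \<longrightarrow> k \<le> H x"
  shows "k * ennreal (b - a) \<le> mass H a b"
proof -
  have "k * ennreal (b - a) = (\<integral>\<^sup>+x\<in>{a<..<b}. k \<partial>lborel)"
    using assms by (subst nn_integral_cmult_indicator) auto
  also have "\<dots> \<le> mass H a b"
    unfolding mass_def using assms(3)
    by (intro nn_integral_mono_AE) (auto elim!: eventually_mono simp: indicator_def)
  finally show ?thesis .
qed

lemma mass_le:
  assumes "a \<le> b" and "AE x in lborel. a < x \<longrightarrow> x < b \<longrightarrow> H x \<le> k"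
  shows "mass H a b \<le> k * ennreal (b - a)"
proof -
  have "mass H a b \<le> (\<integral>\<^sup>+x\<in>{a<..<b}. k \<partial>lborel)"
    unfolding mass_def using assms(2)
    by (intro nn_integral_mono_AE) (auto elim!: eventually_mono simp: indicator_def)
  also have "\<dots> = k * ennreal (b - a)"
    using assms by (subst nn_integral_cmult_indicator) auto
  finally show ?thesis .
qed

lemma AE_lborel_Ioo_witness:
  assumes "AE x in lborel. P x" "a < (b::real)"
  shows "\<exists>x. a < x \<and> x < b \<and> P x"
proof (rule ccontr)
  assume "\<not> ?thesis"
  then have *: "\<And>x. a < x \<Longrightarrow> x < b \<Longrightarrow> \<not> P x" by auto
  have "AE x in lborel. x \<notin> {a<..<b}"
    using assms(1) by (rule eventually_mono) (use * in auto)
  then have "emeasure lborel {a<..<b} = 0"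
    by (subst (asm) AE_iff_measurable[of "{a<..<b}"]) auto
  then show False using assms(2) by simp
qed

lemma mass_pos:
  assumes [measurable]: "H \<in> borel_measurable borel" and "a < b"
    and "AE x in lborel. a < x \<longrightarrow> x < b \<longrightarrow> 0 < H x"
  shows "0 < mass H a b"
proof (rule ccontr)
  assume "\<not> 0 < mass H a b"
  then have "(\<integral>\<^sup>+z\<in>{a<..<b}. H z \<partial>lborel) = 0" by (simp add: mass_def)
  then have "AE z in lborel. H z * indicator {a<..<b} z = 0"
    by (subst (asm) nn_integral_0_iff_AE) auto
  with assms(3) have "AE z in lborel. H z * indicator {a<..<b} z = 0 \<and> (a < z \<longrightarrow> z < b \<longrightarrow> 0 < H z)"
    by eventually_elim auto
  from AE_lborel_Ioo_witness[OF this \<open>a < b\<close>] show False by auto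
qed

context profile_bounds begin

text \<open>A single point with a finite value suffices, since the other factor in the lower bound is positive.\<close>
lemma mass_finite:
  assumes "0 < R" shows "mass H (R/2) (2 * R) < \<infinity>"
proof -
  have "AE x in lborel. (\<forall>R. 0 < x \<longrightarrow> R / 2 < x \<longrightarrow> x < R \<longrightarrow>
      ennreal (c / R\<^sup>2) * (mass H (R/2) x * mass H (R/2) (2 * R)) \<le> H x) \<and> (0 < x \<longrightarrow> H x < \<infinity>)"
    using lower finite_ae by eventually_elim auto
  from AE_lborel_Ioo_witness[OF this, of "R/2" R] assms obtain x where x: "R/2 < x" "x < R"
    and le: "ennreal (c / R\<^sup>2) * (mass H (R/2) x * mass H (R/2) (2 * R)) \<le> H x" and "H x < \<infinity>"
    by auto
  then have fin: "ennreal (c / R\<^sup>2) * (mass H (R/2) x * mass H (R/2) (2 * R)) < \<infinity>" by auto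
  have "0 < mass H (R/2) x"
    using positive x assms by (intro mass_pos) (auto elim!: eventually_mono)
  moreover have "0 < ennreal (c / R\<^sup>2)" using constants assms by simp
  ultimately show ?thesis using fin by (auto simp: ennreal_mult_less_top less_top)
qed

text \<open>Integrating the lower bound over the upper half of \<open>(R/2, R)\<close> gives
  \<open>c / (4 * R) * mass H (R/2) (3/4 * R) * P \<le> mass H (3/4 * R) R \<le> P\<close> with
  \<open>P = mass H (R/2) (2 * R)\<close>. The quadratic inequality becomes linear on cancelling the
  finite and positive factor \<open>P\<close>.\<close>
lemma mass_three_halves:
  assumes "0 < r" shows "mass H r (3/2 * r) \<le> ennreal (8 * r / c)"
proof -
  define R where "R = 2 * r"
  have R: "0 < R" "R/2 = r" "3/4 * R = 3/2 * r" using assms by (auto simp: R_def)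
  define P where "P = mass H (R/2) (2 * R)"
  define G where "G = mass H (R/2) (3/4 * R)"
  have P: "0 < P" "P < \<infinity>"
    unfolding P_def using positive R(1) mass_finite[OF R(1)]
    by (auto intro!: mass_pos elim!: eventually_mono)
  have "ennreal (c / R\<^sup>2) * (G * P) * ennreal (R - 3/4 * R) \<le> mass H (3/4 * R) R"
  proof (rule mass_ge)
    show "AE x in lborel. 3/4 * R < x \<longrightarrow> x < R \<longrightarrow> ennreal (c / R\<^sup>2) * (G * P) \<le> H x"
      using lower
    proof eventually_elim
      case (elim x)
      show ?case
      proof (intro impI)
        assume x: "3/4 * R < x" "x < R"
        have "ennreal (c / R\<^sup>2) * (G * P) \<le> ennreal (c / R\<^sup>2) * (mass H (R/2) x * P)"
          unfolding G_def using x by (intro mult_mono mass_mono) auto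
        also have "\<dots> \<le> H x"
          unfolding P_def using R(1) x by (intro elim[rule_format]) auto
        finally show "ennreal (c / R\<^sup>2) * (G * P) \<le> H x" .
      qed
    qed
  qed (use R in auto)
  also have "\<dots> \<le> 1 * P" unfolding P_def using R by (simp add: mass_mono)
  finally have "(ennreal (c / R\<^sup>2) * ennreal (R - 3/4 * R) * G) * P \<le> 1 * P"
    by (simp add: mult_ac)
  then have *: "ennreal (c / R\<^sup>2) * ennreal (R - 3/4 * R) * G \<le> 1"
    using P by (metis ennreal_mult_le_mult_iff infinity_ennreal_def less_top less_irrefl mult.commute)
  have "ennreal (c / R\<^sup>2) * ennreal (R - 3/4 * R) = ennreal (c / (4 * R))"
    using R constants by (subst ennreal_mult'[symmetric]) (auto simp: power2_eq_square field_simps)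
  with * have "ennreal (4 * R / c) * (ennreal (c / (4 * R)) * G) \<le> ennreal (4 * R / c) * 1"
    by (intro mult_left_mono) auto
  moreover have "ennreal (4 * R / c) * (ennreal (c / (4 * R)) * G) = G"
    using R constants by (simp add: mult.assoc[symmetric] ennreal_mult'[symmetric])
  ultimately show ?thesis unfolding G_def R by (simp add: R_def)
qed

text \<open>Two intervals of ratio \<open>3/2\<close> cover an octave.\<close>
lemma mass_octave:
  assumes "0 < r" shows "mass H r (2 * r) \<le> ennreal (20 / c * r)"
proof -
  have "mass H r (2 * r) \<le> mass H r (3/2 * r) + mass H (3/2 * r) (2 * r)"
    by (rule mass_subadditive) simp
  also have "mass H (3/2 * r) (2 * r) \<le> mass H (3/2 * r) (3/2 * (3/2 * r))"
    using assms by (intro mass_mono) auto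
  also have "mass H r (3/2 * r) + \<dots> \<le> ennreal (8 * r / c) + ennreal (8 * (3/2 * r) / c)"
    using assms by (intro add_mono mass_three_halves) auto
  also have "\<dots> = ennreal (20 / c * r)"
    using assms constants by (subst ennreal_plus[symmetric]) (auto simp: field_simps)
  finally show ?thesis by (auto simp: add_left_mono)
qed

end

section \<open>Boundedness\<close>

text \<open>Bounded averages over octaves behave like a bounded density against powers: the weight
  \<open>z powr (-p)\<close> is dominated by twice the integral of \<open>t powr (-p - 1)\<close> over \<open>(z/2, z)\<close>, and
  after exchanging the integrals the inner one is \<open>mass H t (2 * t)\<close>. The set \<open>E'\<close> is any set that
  contains all these intervals.\<close>
lemma weighted_integral_le:
  assumes [measurable]: "H \<in> borel_measurable borel" "E \<in> sets borel" "E' \<in> sets borel"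
    and p: "0 \<le> p" and A: "0 \<le> A"
    and oct: "\<And>t. 0 < t \<Longrightarrow> mass H t (2 * t) \<le> ennreal (A * t)"
    and E: "E \<subseteq> {0<..}" "\<And>z t. z \<in> E \<Longrightarrow> z / 2 < t \<Longrightarrow> t < z \<Longrightarrow> t \<in> E'"
  shows "(\<integral>\<^sup>+z\<in>E. ennreal (z powr (-p)) * H z \<partial>lborel) \<le>
    ennreal (2 * A) * (\<integral>\<^sup>+t\<in>E'. ennreal (t powr (-p)) \<partial>lborel)"
proof -
  define k where "k t = (if 0 < t then t powr (-p - 1) else 0)" for t :: real
  have [measurable]: "k \<in> borel_measurable borel" unfolding k_def by measurable
  define D where "D t z = (if z / 2 < t \<and> t < z then 1 else 0 :: ennreal)" for t z :: real
  have [measurable]: "(\<lambda>(t, z). D t z) \<in> borel_measurable (borel \<Otimes>\<^sub>M borel)"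
    unfolding D_def by measurable
  have "(\<integral>\<^sup>+z\<in>E. ennreal (z powr (-p)) * H z \<partial>lborel)
      \<le> (\<integral>\<^sup>+z. (\<integral>\<^sup>+t. 2 * (ennreal (k t) * indicator E' t * D t z * H z) \<partial>lborel) \<partial>lborel)"
  proof (rule nn_integral_mono)
    fix z :: real
    show "ennreal (z powr (-p)) * H z * indicator E z
      \<le> (\<integral>\<^sup>+t. 2 * (ennreal (k t) * indicator E' t * D t z * H z) \<partial>lborel)"
    proof (cases "z \<in> E")
      case True
      then have z: "0 < z" using E by auto
      have "ennreal (z powr (-p)) = 2 * ennreal (z powr (-p - 1)) * ennreal (z - z / 2)"
        using z by (simp add: powr_diff ennreal_mult''[symmetric] ennreal_numeral[symmetric] del: ennreal_numeral)
      then have "ennreal (z powr (-p)) * H z * indicator E z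
        = (2 * ennreal (z powr (-p - 1)) * H z) * ennreal (z - z / 2)"
        using True by (simp add: mult_ac)
      also have "\<dots> = (\<integral>\<^sup>+t\<in>{z/2<..<z}. (2 * ennreal (z powr (-p - 1)) * H z) \<partial>lborel)"
        using z by (subst nn_integral_cmult_indicator) auto
      also have "\<dots> \<le> (\<integral>\<^sup>+t. 2 * (ennreal (k t) * indicator E' t * D t z * H z) \<partial>lborel)"
      proof (rule nn_integral_mono)
        fix t :: real
        show "(2 * ennreal (z powr (-p - 1)) * H z) * indicator {z/2<..<z} t
          \<le> 2 * (ennreal (k t) * indicator E' t * D t z * H z)"
        proof (cases "t \<in> {z/2<..<z}")
          case t: True
          then have "z powr (-p - 1) \<le> k t"
            unfolding k_def using z p by (auto intro!: powr_mono2')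
          then have "2 * ennreal (z powr (-p - 1)) * H z \<le> 2 * ennreal (k t) * H z"
            by (intro mult_mono ennreal_leI) auto
          then show ?thesis using t E(2)[OF True, of t] by (simp add: D_def mult_ac)
        qed auto
      qed
      finally show ?thesis .
    qed auto
  qed
  also have "\<dots> = (\<integral>\<^sup>+t. (\<integral>\<^sup>+z. 2 * (ennreal (k t) * indicator E' t * D t z * H z) \<partial>lborel) \<partial>lborel)"
    by (rule lborel_pair.Fubini') measurable
  also have "\<dots> \<le> (\<integral>\<^sup>+t. ennreal (2 * A) * (ennreal (t powr (-p)) * indicator E' t) \<partial>lborel)"
  proof (rule nn_integral_mono)
    fix t :: real
    show "(\<integral>\<^sup>+z. 2 * (ennreal (k t) * indicator E' t * D t z * H z) \<partial>lborel)
      \<le> ennreal (2 * A) * (ennreal (t powr (-p)) * indicator E' t)"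
    proof (cases "0 < t \<and> t \<in> E'")
      case True
      have "(\<integral>\<^sup>+z. 2 * (ennreal (k t) * indicator E' t * D t z * H z) \<partial>lborel)
        = (\<integral>\<^sup>+z. (2 * ennreal (k t)) * (H z * indicator {t<..<2*t} z) \<partial>lborel)"
        using True by (intro nn_integral_cong) (auto simp: D_def indicator_def mult_ac)
      also have "\<dots> = 2 * ennreal (k t) * mass H t (2 * t)"
        unfolding mass_def by (subst nn_integral_cmult) auto
      also have "\<dots> \<le> 2 * ennreal (k t) * ennreal (A * t)"
        using True oct by (intro mult_left_mono) auto
      also have "\<dots> = ennreal (2 * k t * (A * t))"
        using True by (simp add: ennreal_mult' k_def)
      also have "2 * k t * (A * t) = 2 * A * t powr (-p)"
        using True by (simp add: k_def powr_diff)
      finally show ?thesis using True A by (simp add: ennreal_mult' mult_ac)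
    qed (auto simp: k_def)
  qed
  also have "\<dots> = ennreal (2 * A) * (\<integral>\<^sup>+t\<in>E'. ennreal (t powr (-p)) \<partial>lborel)"
    by (rule nn_integral_cmult) measurable
  finally show ?thesis .
qed

context profile_bounds begin

lemma tail_rate_le:
  assumes "0 < w"
  shows "tail_rate \<alpha> H w \<le> ennreal (40 * 2 powr \<alpha> / (c * \<alpha>))"
proof -
  have "(\<integral>\<^sup>+z\<in>{w<..}. ennreal (z powr (-(1 + \<alpha>))) * H z \<partial>lborel)
     \<le> ennreal (2 * (20 / c)) * (\<integral>\<^sup>+t\<in>{w/2<..}. ennreal (t powr (-(1 + \<alpha>))) \<partial>lborel)"
    using assms exponents constants mass_octave by (intro weighted_integral_le) auto
  also have "\<dots> = ennreal (2 * (20 / c) * ((w/2) powr (-\<alpha>) / \<alpha>))"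
    using assms exponents constants set_nn_integral_powr_tail[of \<alpha> "w/2"]
    by (simp add: ennreal_mult'[symmetric])
  finally have "tail_rate \<alpha> H w \<le> ennreal (w powr \<alpha>) * ennreal (2 * (20 / c) * ((w/2) powr (-\<alpha>) / \<alpha>))"
    unfolding tail_rate_def by (intro mult_left_mono) auto
  also have "\<dots> = ennreal (40 * 2 powr \<alpha> / (c * \<alpha>))"
    using assms exponents constants
    by (simp add: ennreal_mult'[symmetric] powr_divide powr_minus field_simps)
  finally show ?thesis .
qed

lemma head_integral_le:
  assumes "0 \<le> p" "p < 1" "0 < x"
  shows "(\<integral>\<^sup>+z\<in>{0<..<x}. ennreal (z powr (-p)) * H z \<partial>lborel)
    \<le> ennreal (40 / c * (x powr (1 - p) / (1 - p)))"
proof -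
  have "(\<integral>\<^sup>+z\<in>{0<..<x}. ennreal (z powr (-p)) * H z \<partial>lborel)
     \<le> ennreal (2 * (20 / c)) * (\<integral>\<^sup>+t\<in>{0<..<x}. ennreal (t powr (-p)) \<partial>lborel)"
    using assms constants mass_octave by (intro weighted_integral_le) auto
  then show ?thesis
    using assms constants set_nn_integral_powr_head[of p x] by (simp add: ennreal_mult'[symmetric])
qed

lemma upper_const_rate:
  assumes "0 \<le> \<rho>" "\<And>w. 0 < w \<Longrightarrow> tail_rate \<alpha> H w \<le> ennreal \<rho>"
  shows "AE x in lborel. 0 < x \<longrightarrow> H x \<le> ennreal (C * \<rho> * x powr (2 * \<beta> - 1)) *
      (\<integral>\<^sup>+y\<in>{0<..<x}. ennreal (y powr (-\<beta>) * (x - y) powr (-\<beta>)) * H y \<partial>lborel)"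
  using upper
proof eventually_elim
  case (elim x)
  show ?case
  proof
    assume x: "0 < x"
    let ?J = "\<integral>\<^sup>+y\<in>{0<..<x}. ennreal (y powr (-\<beta>) * (x - y) powr (-\<beta>)) * H y \<partial>lborel"
    have "(\<integral>\<^sup>+y\<in>{0<..<x}. ennreal (y powr (-\<beta>) * (x - y) powr (-\<beta>)) * (tail_rate \<alpha> H (x - y) * H y) \<partial>lborel)
      \<le> (\<integral>\<^sup>+y. ennreal \<rho> * (ennreal (y powr (-\<beta>) * (x - y) powr (-\<beta>)) * H y * indicator {0<..<x} y) \<partial>lborel)"
    proof (rule nn_integral_mono)
      fix y
      show "ennreal (y powr (-\<beta>) * (x - y) powr (-\<beta>)) * (tail_rate \<alpha> H (x - y) * H y) * indicator {0<..<x} y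
        \<le> ennreal \<rho> * (ennreal (y powr (-\<beta>) * (x - y) powr (-\<beta>)) * H y * indicator {0<..<x} y)"
      proof (cases "y \<in> {0<..<x}")
        case True
        then have "tail_rate \<alpha> H (x - y) \<le> ennreal \<rho>" using assms by auto
        then have "ennreal (y powr (-\<beta>) * (x - y) powr (-\<beta>)) * (tail_rate \<alpha> H (x - y) * H y)
          \<le> ennreal (y powr (-\<beta>) * (x - y) powr (-\<beta>)) * (ennreal \<rho> * H y)"
          by (intro mult_mono) auto
        then show ?thesis using True by (simp add: mult_ac)
      qed auto
    qed
    also have "\<dots> = ennreal \<rho> * ?J" by (rule nn_integral_cmult) measurable
    finally have "H x \<le> ennreal (C * x powr (2 * \<beta> - 1)) * (ennreal \<rho> * ?J)"
      using elim x by (meson mult_left_mono order_trans zero_le)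
    also have "\<dots> = ennreal (C * \<rho> * x powr (2 * \<beta> - 1)) * ?J"
      using assms constants by (simp add: ennreal_mult' mult_ac)
    finally show "H x \<le> \<dots>" .
  qed
qed

text \<open>The upper bound with a constant rate has the form \<open>H \<le> D * A H\<close> with a weakly singular
  convolution operator \<open>A\<close>. It does not map averages to bounded functions, but its square does, because
  \<open>\<beta> < 1/2\<close>: the kernel of \<open>A (A H)\<close> is bounded near the diagonal.\<close>
lemma bounded:
  fixes D :: real
  defines "D \<equiv> C * (40 * 2 powr \<alpha> / (c * \<alpha>))"
  shows "AE x in lborel. 0 < x \<longrightarrow>
    H x \<le> ennreal (D\<^sup>2 * Beta (1/2) (1 - \<beta>) * (40 / c) / (1/2 - \<beta>))"
proof -
  define b where "b = Beta (1/2) (1 - \<beta>)"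
  have b: "0 < b" unfolding b_def using exponents by (simp add: Beta_def Gamma_real_pos)
  have D: "0 < D" using exponents constants by (simp add: D_def)
  define k where "k x y = (if 0 < y \<and> y < x then y powr (-\<beta>) * (x - y) powr (-\<beta>) else 0)" for x y :: real
  have [measurable]: "(\<lambda>(x, y). k x y) \<in> borel_measurable (borel \<Otimes>\<^sub>M borel)"
    unfolding k_def by measurable
  have step: "AE x in lborel. 0 < x \<longrightarrow> H x \<le> ennreal (D * x powr (2 * \<beta> - 1)) *
      (\<integral>\<^sup>+y. ennreal (k x y) * H y \<partial>lborel)"
  proof -
    have eq: "(\<integral>\<^sup>+y\<in>{0<..<x}. ennreal (y powr (-\<beta>) * (x - y) powr (-\<beta>)) * H y \<partial>lborel)
      = (\<integral>\<^sup>+y. ennreal (k x y) * H y \<partial>lborel)" for x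
      by (intro nn_integral_cong) (auto simp: k_def indicator_def)
    show ?thesis
      using upper_const_rate[OF _ tail_rate_le] exponents constants
      unfolding eq by (simp add: D_def)
  qed
  have iterate: "(\<integral>\<^sup>+y. ennreal (k x y) * H y \<partial>lborel)
      \<le> ennreal (D * b * (40 / c) / (1/2 - \<beta>) * x powr (1 - 2 * \<beta>))" if x: "0 < x" for x
  proof -
    define W where "W y z = (if 0 < z \<and> z < y \<and> y < x then (y - z) powr (-(1/2)) * (x - y) powr (-\<beta>) else 0)"
      for y z :: real
    have [measurable]: "(\<lambda>(x, y). W x y) \<in> borel_measurable (borel \<Otimes>\<^sub>M borel)"
      unfolding W_def by measurable
    define V where "V z = (if 0 < z \<and> z < x then z powr (-(\<beta> + 1/2)) else 0)" for z :: real
    have [measurable]: "V \<in> borel_measurable borel"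
      unfolding V_def by measurable
    have key: "k x y * (D * y powr (2 * \<beta> - 1)) * k y z \<le> D * W y z * V z" for y z
    proof (cases "0 < z \<and> z < y \<and> y < x")
      case True
      \<comment> \<open>Half a power is moved to \<open>z\<close>, where it is integrable against \<open>H\<close>; moving all of
        \<open>\<beta> - 1\<close> there would leave a logarithmic divergence at 0.\<close>
      have "y powr (\<beta> - 1) = y powr (\<beta> - 1/2) * y powr (-(1/2))"
        using True by (simp add: powr_add[symmetric])
      also have "\<dots> \<le> (y - z) powr (\<beta> - 1/2) * z powr (-(1/2))"
        using True exponents by (intro mult_mono powr_mono2') auto
      finally have *: "y powr (\<beta> - 1) \<le> (y - z) powr (\<beta> - 1/2) * z powr (-(1/2))" .
      have "k x y * (D * y powr (2 * \<beta> - 1)) * k y z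
        = D * ((x - y) powr (-\<beta>) * (y powr (-\<beta>) * y powr (2 * \<beta> - 1)) * (z powr (-\<beta>) * (y - z) powr (-\<beta>)))"
        using True by (simp add: k_def)
      also have "y powr (-\<beta>) * y powr (2 * \<beta> - 1) = y powr (\<beta> - 1)"
        using True by (simp add: powr_add[symmetric])
      also have "D * ((x - y) powr (-\<beta>) * (y powr (\<beta> - 1)) * (z powr (-\<beta>) * (y - z) powr (-\<beta>)))
        \<le> D * ((x - y) powr (-\<beta>) * ((y - z) powr (\<beta> - 1/2) * z powr (-(1/2))) * (z powr (-\<beta>) * (y - z) powr (-\<beta>)))"
        using * D True by (intro mult_left_mono mult_right_mono) auto
      also have "\<dots> = D * ((x - y) powr (-\<beta>) * ((y - z) powr (\<beta> - 1/2) * (y - z) powr (-\<beta>)) * (z powr (-(1/2)) * z powr (-\<beta>)))"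
        by (simp only: mult_ac)
      also have "\<dots> = D * W y z * V z"
        using True by (simp add: W_def V_def powr_add[symmetric] algebra_simps)
      finally show ?thesis .
    next
      case False
      then show ?thesis using D by (auto simp: k_def W_def V_def)
    qed
    have "(\<integral>\<^sup>+y. ennreal (k x y) * H y \<partial>lborel)
        \<le> (\<integral>\<^sup>+y. ennreal (k x y) * (ennreal (D * y powr (2 * \<beta> - 1)) *
          (\<integral>\<^sup>+z. ennreal (k y z) * H z \<partial>lborel)) \<partial>lborel)"
      using step
      by (intro nn_integral_mono_AE) (auto elim!: eventually_mono simp: k_def intro!: mult_left_mono)
    also have "\<dots> = (\<integral>\<^sup>+y. (\<integral>\<^sup>+z. ennreal (k x y) * (ennreal (D * y powr (2 * \<beta> - 1)) *
          (ennreal (k y z) * H z)) \<partial>lborel) \<partial>lborel)"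
      by (simp add: nn_integral_cmult)
    also have "\<dots> \<le> (\<integral>\<^sup>+y. (\<integral>\<^sup>+z. ennreal (D * V z) * H z * ennreal (W y z) \<partial>lborel) \<partial>lborel)"
    proof (intro nn_integral_mono)
      fix y z
      have "ennreal (k x y) * (ennreal (D * y powr (2 * \<beta> - 1)) * (ennreal (k y z) * H z))
        = ennreal (k x y * (D * y powr (2 * \<beta> - 1)) * k y z) * H z"
        using D by (simp add: k_def ennreal_mult' mult.assoc)
      also have "\<dots> \<le> ennreal (D * W y z * V z) * H z"
        using key by (intro mult_right_mono ennreal_leI) auto
      also have "\<dots> = ennreal (D * V z) * H z * ennreal (W y z)"
      proof -
        have "0 \<le> W y z" "0 \<le> V z" "0 \<le> D" using D by (auto simp: W_def V_def)
        then show ?thesis by (simp add: ennreal_mult mult_ac)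
      qed
      finally show "ennreal (k x y) * (ennreal (D * y powr (2 * \<beta> - 1)) * (ennreal (k y z) * H z))
        \<le> ennreal (D * V z) * H z * ennreal (W y z)" .
    qed
    also have "\<dots> = (\<integral>\<^sup>+z. (\<integral>\<^sup>+y. ennreal (D * V z) * H z * ennreal (W y z) \<partial>lborel) \<partial>lborel)"
      by (rule lborel_pair.Fubini') measurable
    also have "\<dots> \<le> (\<integral>\<^sup>+z. ennreal (D * b * x powr (1/2 - \<beta>)) * (ennreal (z powr (-(\<beta> + 1/2))) * H z * indicator {0<..<x} z) \<partial>lborel)"
    proof (intro nn_integral_mono)
      fix z
      show "(\<integral>\<^sup>+y. ennreal (D * V z) * H z * ennreal (W y z) \<partial>lborel)
        \<le> ennreal (D * b * x powr (1/2 - \<beta>)) * (ennreal (z powr (-(\<beta> + 1/2))) * H z * indicator {0<..<x} z)"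
      proof (cases "0 < z \<and> z < x")
        case True
        have "(\<integral>\<^sup>+y. ennreal (W y z) \<partial>lborel)
          = (\<integral>\<^sup>+y\<in>{z<..<x}. ennreal ((y - z) powr (-(1/2)) * (x - y) powr (-\<beta>)) \<partial>lborel)"
          using True by (intro nn_integral_cong) (auto simp: W_def indicator_def)
        also have "\<dots> = ennreal ((x - z) powr (1/2 - \<beta>) * b)"
          unfolding b_def using set_nn_integral_powr_conv[of "1/2" \<beta> z x] True exponents by simp
        also have "\<dots> \<le> ennreal (b * x powr (1/2 - \<beta>))"
          using True exponents b by (auto intro!: ennreal_leI mult_left_mono powr_mono2 simp: mult.commute)
        finally have "(\<integral>\<^sup>+y. ennreal (D * V z) * H z * ennreal (W y z) \<partial>lborel)
          \<le> ennreal (D * V z) * H z * ennreal (b * x powr (1/2 - \<beta>))"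
          by (subst nn_integral_cmult) (auto intro!: mult_left_mono)
        also have "\<dots> = ennreal (D * b * x powr (1/2 - \<beta>)) * (ennreal (z powr (-(\<beta> + 1/2))) * H z * indicator {0<..<x} z)"
          using True D b by (simp add: V_def ennreal_mult' mult_ac)
        finally show ?thesis .
      qed (auto simp: V_def)
    qed
    also have "\<dots> = ennreal (D * b * x powr (1/2 - \<beta>)) * (\<integral>\<^sup>+z\<in>{0<..<x}. ennreal (z powr (-(\<beta> + 1/2))) * H z \<partial>lborel)"
      by (rule nn_integral_cmult) measurable
    also have "\<dots> \<le> ennreal (D * b * x powr (1/2 - \<beta>)) * ennreal (40 / c * (x powr (1 - (\<beta> + 1/2)) / (1 - (\<beta> + 1/2))))"
      using x exponents by (intro mult_left_mono head_integral_le) auto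
    also have "\<dots> = ennreal (D * b * (40 / c) / (1/2 - \<beta>) * x powr (1 - 2 * \<beta>))"
    proof -
      have "D * b * x powr (1/2 - \<beta>) * (40 / c * (x powr (1 - (\<beta> + 1/2)) / (1 - (\<beta> + 1/2))))
        = D * b * (40 / c) / (1/2 - \<beta>) * (x powr (1/2 - \<beta>) * x powr (1/2 - \<beta>))"
        by (simp add: divide_simps)
      also have "x powr (1/2 - \<beta>) * x powr (1/2 - \<beta>) = x powr (1 - 2 * \<beta>)"
        by (simp add: powr_add[symmetric])
      finally show ?thesis using D b by (subst ennreal_mult'[symmetric]) (auto simp only: mult_nonneg_nonneg powr_ge_zero order_less_imp_le)
    qed
    finally show ?thesis .
  qed
  show ?thesis using step
  proof eventually_elim
    case (elim x)
    show ?case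
    proof
      assume x: "0 < x"
      have "H x \<le> ennreal (D * x powr (2 * \<beta> - 1)) * (\<integral>\<^sup>+y. ennreal (k x y) * H y \<partial>lborel)"
        using elim x by simp
      also have "\<dots> \<le> ennreal (D * x powr (2 * \<beta> - 1)) *
          ennreal (D * b * (40 / c) / (1/2 - \<beta>) * x powr (1 - 2 * \<beta>))"
        using iterate[OF x] by (intro mult_left_mono) auto
      also have "\<dots> = ennreal (D\<^sup>2 * b * (40 / c) / (1/2 - \<beta>) * (x powr (2 * \<beta> - 1) * x powr (1 - 2 * \<beta>)))"
        using D by (simp add: ennreal_mult'[symmetric] power2_eq_square mult_ac)
      also have "x powr (2 * \<beta> - 1) * x powr (1 - 2 * \<beta>) = 1"
        using x by (simp add: powr_add[symmetric])
      finally show "H x \<le> ennreal (D\<^sup>2 * Beta (1/2) (1 - \<beta>) * (40 / c) / (1/2 - \<beta>))"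
        by (simp add: b_def)
    qed
  qed
qed

end

section \<open>Absorption and weighted estimates\<close>

text \<open>An absorption principle: if every bound \<open>S\<close> improves to \<open>S0 + S/2\<close>, then \<open>2 * S0\<close> is a bound.
  One finite bound \<open>S1\<close> is needed to start the iteration.\<close>
lemma AE_le_by_halving:
  fixes F :: "'a \<Rightarrow> ennreal" and g :: "'a \<Rightarrow> real"
  assumes S0: "0 \<le> S0" and S1: "0 \<le> S1" and g: "\<And>x. P x \<Longrightarrow> 0 \<le> g x"
    and start: "AE x in M. P x \<longrightarrow> F x \<le> ennreal (S1 * g x)"
    and step: "\<And>S. 0 \<le> S \<Longrightarrow> AE x in M. P x \<longrightarrow> F x \<le> ennreal (S * g x) \<Longrightarrow>
       AE x in M. P x \<longrightarrow> F x \<le> ennreal ((S0 + S / 2) * g x)"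
  shows "AE x in M. P x \<longrightarrow> F x \<le> ennreal (2 * S0 * g x)"
proof -
  have all: "AE x in M. P x \<longrightarrow> F x \<le> ennreal ((2 * S0 + S1 / 2 ^ n) * g x)" for n :: nat
  proof (induction n)
    case 0
    show ?case using start
    proof eventually_elim
      case (elim x)
      have "ennreal (S1 * g x) \<le> ennreal ((2 * S0 + S1 / 2 ^ 0) * g x)" if "P x"
        using g[OF that] S0 by (intro ennreal_leI mult_right_mono) auto
      with elim show ?case by (auto elim: order_trans)
    qed
  next
    case (Suc n)
    have "AE x in M. P x \<longrightarrow> F x \<le> ennreal ((S0 + (2 * S0 + S1 / 2 ^ n) / 2) * g x)"
      by (rule step) (use S0 S1 Suc.IH in auto)
    then show ?case by (simp add: field_simps)
  qed
  from all have "AE x in M. \<forall>n::nat. P x \<longrightarrow> F x \<le> ennreal ((2 * S0 + S1 / 2 ^ n) * g x)"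
    by (subst AE_all_countable) blast
  then show ?thesis
  proof eventually_elim
    case (elim x)
    show ?case
    proof
      assume "P x"
      have "(\<lambda>n::nat. (2 * S0 + S1 * (1/2) ^ n) * g x) \<longlonglongrightarrow> (2 * S0 + S1 * 0) * g x"
        by (intro tendsto_intros LIMSEQ_power_zero) auto
      moreover have "S1 * (1/2) ^ n = S1 / 2 ^ n" for n :: nat by (simp add: power_one_over)
      ultimately have "(\<lambda>n::nat. (2 * S0 + S1 / 2 ^ n) * g x) \<longlonglongrightarrow> 2 * S0 * g x" by simp
      then have "(\<lambda>n::nat. ennreal ((2 * S0 + S1 / 2 ^ n) * g x)) \<longlonglongrightarrow> ennreal (2 * S0 * g x)"
        by (rule tendsto_ennrealI)
      then show "F x \<le> ennreal (2 * S0 * g x)"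
        using elim \<open>P x\<close> by (intro LIMSEQ_le_const) auto
    qed
  qed
qed

lemma abel_integral_le:
  assumes "r < 1" "p < 1" "0 < x" "0 \<le> S"
    and "AE y in lborel. 0 < y \<longrightarrow> y < x \<longrightarrow> F y \<le> ennreal (S * y powr q)"
    and "p = s - q"
  shows "(\<integral>\<^sup>+y\<in>{0<..<x}. ennreal (y powr (-s) * (x - y) powr (-r)) * F y \<partial>lborel)
    \<le> ennreal (S * Beta (1 - p) (1 - r) * x powr (1 - p - r))"
proof -
  have "(\<integral>\<^sup>+y\<in>{0<..<x}. ennreal (y powr (-s) * (x - y) powr (-r)) * F y \<partial>lborel)
    \<le> (\<integral>\<^sup>+y. ennreal S * (ennreal ((y - 0) powr (-p) * (x - y) powr (-r)) * indicator {0<..<x} y) \<partial>lborel)"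
  proof (rule nn_integral_mono_AE)
    show "AE y in lborel. ennreal (y powr (-s) * (x - y) powr (-r)) * F y * indicator {0<..<x} y
      \<le> ennreal S * (ennreal ((y - 0) powr (-p) * (x - y) powr (-r)) * indicator {0<..<x} y)"
      using assms(5)
    proof eventually_elim
      case (elim y)
      show ?case
      proof (cases "y \<in> {0<..<x}")
        case True
        have "ennreal (y powr (-s) * (x - y) powr (-r)) * F y
          \<le> ennreal (y powr (-s) * (x - y) powr (-r)) * ennreal (S * y powr q)"
          using elim True by (intro mult_left_mono) auto
        also have "\<dots> = ennreal (S * ((y powr (-s) * y powr q) * (x - y) powr (-r)))"
          using assms(4) by (simp add: ennreal_mult mult_ac)
        also have "y powr (-s) * y powr q = y powr (-p)"
          using assms(6) by (simp add: powr_add[symmetric])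
        finally show ?thesis using True assms(4) by (simp add: ennreal_mult')
      qed auto
    qed
  qed
  also have "\<dots> = ennreal S * ennreal ((x - 0) powr (1 - p - r) * Beta (1 - p) (1 - r))"
    using set_nn_integral_powr_conv[of p r 0 x] assms by (subst nn_integral_cmult) auto
  also have "\<dots> = ennreal (S * Beta (1 - p) (1 - r) * x powr (1 - p - r))"
    using assms by (simp add: ennreal_mult'[symmetric] mult_ac)
  finally show ?thesis .
qed

text \<open>From here on \<open>H\<close> is bounded by a constant \<open>M\<close>, such as the one found above.\<close>
locale bounded_profile = profile_bounds +
  fixes M :: real
  assumes M_pos: "0 < M"
    and le_M: "AE x in lborel. 0 < x \<longrightarrow> H x \<le> ennreal M"
begin

lemma tail_rate_split:
  assumes w: "0 < w" "w \<le> X" and \<delta>: "0 \<le> \<delta>"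
    and small: "AE x in lborel. w < x \<longrightarrow> x < X \<longrightarrow> H x \<le> ennreal \<delta>"
  shows "tail_rate \<alpha> H w \<le> ennreal (\<delta> / \<alpha> + M / \<alpha> * (w / X) powr \<alpha>)"
proof -
  have "(\<integral>\<^sup>+z\<in>{w<..}. ennreal (z powr (-1 - \<alpha>)) * H z \<partial>lborel)
    \<le> (\<integral>\<^sup>+z. ennreal \<delta> * (ennreal (z powr (-1 - \<alpha>)) * indicator {w<..} z)
         + ennreal M * (ennreal (z powr (-1 - \<alpha>)) * indicator {X<..} z) \<partial>lborel)"
  proof (rule nn_integral_mono_AE)
    show "AE z in lborel. ennreal (z powr (-1 - \<alpha>)) * H z * indicator {w<..} z
      \<le> ennreal \<delta> * (ennreal (z powr (-1 - \<alpha>)) * indicator {w<..} z)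
         + ennreal M * (ennreal (z powr (-1 - \<alpha>)) * indicator {X<..} z)"
      using small le_M AE_lborel_singleton[of X]
    proof eventually_elim
      case (elim z)
      consider "z \<le> w" | "w < z" "z < X" | "X < z" using elim by linarith
      then show ?case
      proof cases
        case 2
        then have "ennreal (z powr (-1 - \<alpha>)) * H z \<le> ennreal (z powr (-1 - \<alpha>)) * ennreal \<delta>"
          using elim by (intro mult_left_mono) auto
        then show ?thesis using 2 by (simp add: mult.commute)
      next
        case 3
        then have "ennreal (z powr (-1 - \<alpha>)) * H z \<le> ennreal (z powr (-1 - \<alpha>)) * ennreal M"
          using elim w by (intro mult_left_mono) auto
        then show ?thesis using 3 w by (simp add: mult.commute add_increasing)
      qed auto
    qed
  qed
  also have "\<dots> = ennreal \<delta> * ennreal (w powr (-\<alpha>) / \<alpha>) + ennreal M * ennreal (X powr (-\<alpha>) / \<alpha>)"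
    using set_nn_integral_powr_tail[of \<alpha> w] set_nn_integral_powr_tail[of \<alpha> X] w exponents
    by (subst nn_integral_linear_combination) simp_all
  also have "\<dots> = ennreal (\<delta> * w powr (-\<alpha>) / \<alpha> + M * X powr (-\<alpha>) / \<alpha>)"
    using \<delta> M_pos exponents by (simp add: ennreal_mult'[symmetric] ennreal_plus[symmetric] del: ennreal_plus)
  finally have "tail_rate \<alpha> H w \<le> ennreal (w powr \<alpha>) * ennreal (\<delta> * w powr (-\<alpha>) / \<alpha> + M * X powr (-\<alpha>) / \<alpha>)"
    unfolding tail_rate_def by (intro mult_left_mono) auto
  also have "\<dots> = ennreal (w powr \<alpha> * (\<delta> * w powr (-\<alpha>) / \<alpha> + M * X powr (-\<alpha>) / \<alpha>))"
    by (simp add: ennreal_mult')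
  also have "w powr \<alpha> * (\<delta> * w powr (-\<alpha>) / \<alpha> + M * X powr (-\<alpha>) / \<alpha>)
      = \<delta> / \<alpha> + M / \<alpha> * (w / X) powr \<alpha>"
    using w by (simp add: powr_minus powr_divide field_simps)
  finally show ?thesis .
qed

lemma tail_rate_le_const:
  assumes "0 < w" "0 \<le> \<delta>" "AE x in lborel. w < x \<longrightarrow> H x \<le> ennreal \<delta>"
  shows "tail_rate \<alpha> H w \<le> ennreal (\<delta> / \<alpha>)"
proof -
  have "(\<integral>\<^sup>+z\<in>{w<..}. ennreal (z powr (-1 - \<alpha>)) * H z \<partial>lborel)
    \<le> (\<integral>\<^sup>+z. ennreal \<delta> * (ennreal (z powr (-1 - \<alpha>)) * indicator {w<..} z) \<partial>lborel)"
    using assms(3)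
    by (intro nn_integral_mono_AE) (auto elim!: eventually_mono simp: indicator_def mult.commute intro!: mult_right_mono)
  also have "\<dots> = ennreal \<delta> * ennreal (w powr (-\<alpha>) / \<alpha>)"
    using set_nn_integral_powr_tail[of \<alpha> w] assms exponents by (subst nn_integral_cmult) auto
  finally have "tail_rate \<alpha> H w \<le> ennreal (w powr \<alpha>) * (ennreal \<delta> * ennreal (w powr (-\<alpha>) / \<alpha>))"
    unfolding tail_rate_def by (intro mult_left_mono) auto
  also have "\<dots> = ennreal (\<delta> / \<alpha>)"
    using assms exponents by (simp add: ennreal_mult'[symmetric] powr_minus)
  finally show ?thesis .
qed

lemma tail_rate_le_M: "0 < w \<Longrightarrow> tail_rate \<alpha> H w \<le> ennreal (M / \<alpha>)"
  using le_M M_pos by (intro tail_rate_le_const) (auto elim!: eventually_mono)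

text \<open>The upper bound evaluated under a power bound on \<open>H\<close> to the left of \<open>x\<close> and a bound on the rate
  which is allowed to be worse by a half power near 0. For almost every \<open>x\<close> all parameters may be
  chosen freely.\<close>
lemma upper_power:
  "AE x in lborel. \<forall>S q \<rho> \<sigma>. 0 < x \<longrightarrow> 0 \<le> S \<longrightarrow> -1/4 \<le> q \<longrightarrow> 0 \<le> \<rho> \<longrightarrow> 0 \<le> \<sigma> \<longrightarrow>
     (\<forall>w. 0 < w \<longrightarrow> w < x \<longrightarrow> tail_rate \<alpha> H w \<le> ennreal (\<rho> + \<sigma> * w powr (-(1/2)))) \<longrightarrow>
     (AE y in lborel. 0 < y \<longrightarrow> y < x \<longrightarrow> H y \<le> ennreal (S * y powr q)) \<longrightarrow>
     H x \<le> ennreal (C * S * (\<rho> * Beta (1 - \<beta> + q) (1 - \<beta>)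
        + \<sigma> * x powr (-(1/2)) * Beta (1 - \<beta> + q) (1/2 - \<beta>)) * x powr q)"
  using upper
proof eventually_elim
  case (elim x)
  show ?case
  proof (intro allI impI)
    fix S q \<rho> \<sigma> :: real
    assume x: "0 < x" and S: "0 \<le> S" and q: "-1/4 \<le> q" and \<rho>: "0 \<le> \<rho>" and \<sigma>: "0 \<le> \<sigma>"
      and rate: "\<forall>w. 0 < w \<longrightarrow> w < x \<longrightarrow> tail_rate \<alpha> H w \<le> ennreal (\<rho> + \<sigma> * w powr (-(1/2)))"
      and small: "AE y in lborel. 0 < y \<longrightarrow> y < x \<longrightarrow> H y \<le> ennreal (S * y powr q)"
    let ?B0 = "Beta (1 - \<beta> + q) (1 - \<beta>)" and ?B1 = "Beta (1 - \<beta> + q) (1/2 - \<beta>)"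
    have B: "0 \<le> ?B0" "0 \<le> ?B1" using exponents q by (auto intro!: Beta_nonneg_real)
    define J where "J r = (\<integral>\<^sup>+y\<in>{0<..<x}. ennreal (y powr (-\<beta>) * (x - y) powr (-r)) * H y \<partial>lborel)" for r
    have J: "J r \<le> ennreal (S * Beta (1 - (\<beta> - q)) (1 - r) * x powr (1 - (\<beta> - q) - r))" if "r < 1" for r
      unfolding J_def using x S q exponents small that by (intro abel_integral_le) auto
    have "(\<integral>\<^sup>+y\<in>{0<..<x}. ennreal (y powr (-\<beta>) * (x - y) powr (-\<beta>)) * (tail_rate \<alpha> H (x - y) * H y) \<partial>lborel)
      \<le> (\<integral>\<^sup>+y. ennreal \<rho> * (ennreal (y powr (-\<beta>) * (x - y) powr (-\<beta>)) * H y * indicator {0<..<x} y)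
        + ennreal \<sigma> * (ennreal (y powr (-\<beta>) * (x - y) powr (-(\<beta> + 1/2))) * H y * indicator {0<..<x} y) \<partial>lborel)"
    proof (rule nn_integral_mono)
      fix y
      show "ennreal (y powr (-\<beta>) * (x - y) powr (-\<beta>)) * (tail_rate \<alpha> H (x - y) * H y) * indicator {0<..<x} y
        \<le> ennreal \<rho> * (ennreal (y powr (-\<beta>) * (x - y) powr (-\<beta>)) * H y * indicator {0<..<x} y)
        + ennreal \<sigma> * (ennreal (y powr (-\<beta>) * (x - y) powr (-(\<beta> + 1/2))) * H y * indicator {0<..<x} y)"
      proof (cases "y \<in> {0<..<x}")
        case True
        let ?k = "y powr (-\<beta>) * (x - y) powr (-\<beta>)"
        have "ennreal ?k * (tail_rate \<alpha> H (x - y) * H y)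
          \<le> ennreal ?k * (ennreal (\<rho> + \<sigma> * (x - y) powr (-(1/2))) * H y)"
          using True rate by (intro mult_left_mono mult_right_mono) auto
        also have "\<dots> = ennreal (?k * (\<rho> + \<sigma> * (x - y) powr (-(1/2)))) * H y"
          by (simp add: ennreal_mult' mult.assoc)
        also have "?k * (\<rho> + \<sigma> * (x - y) powr (-(1/2)))
            = \<rho> * ?k + \<sigma> * (y powr (-\<beta>) * ((x - y) powr (-\<beta>) * (x - y) powr (-(1/2))))"
          by (simp add: algebra_simps)
        also have "(x - y) powr (-\<beta>) * (x - y) powr (-(1/2)) = (x - y) powr (-(\<beta> + 1/2))"
          by (simp add: powr_add[symmetric])
        also have "ennreal (\<rho> * ?k + \<sigma> * (y powr (-\<beta>) * (x - y) powr (-(\<beta> + 1/2)))) * H y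
          = ennreal \<rho> * (ennreal ?k * H y) + ennreal \<sigma> * (ennreal (y powr (-\<beta>) * (x - y) powr (-(\<beta> + 1/2))) * H y)"
          using \<rho> \<sigma> by (simp add: ennreal_plus ennreal_mult' distrib_right mult.assoc)
        finally show ?thesis using True by simp
      qed auto
    qed
    also have "\<dots> = ennreal \<rho> * J \<beta> + ennreal \<sigma> * J (\<beta> + 1/2)"
      unfolding J_def by (rule nn_integral_linear_combination) measurable
    also have "\<dots> \<le> ennreal \<rho> * ennreal (S * ?B0 * x powr (1 - 2 * \<beta> + q))
        + ennreal \<sigma> * ennreal (S * ?B1 * x powr (1 - 2 * \<beta> + q - 1/2))"
      using J[of \<beta>] J[of "\<beta> + 1/2"] exponents
      by (intro add_mono mult_left_mono) (auto simp: algebra_simps)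
    also have "\<dots> = ennreal (\<rho> * (S * ?B0 * x powr (1 - 2 * \<beta> + q)) + \<sigma> * (S * ?B1 * x powr (1 - 2 * \<beta> + q - 1/2)))"
      using B S \<rho> \<sigma> by (subst ennreal_plus) (auto simp: ennreal_mult')
    finally have "H x \<le> ennreal (C * x powr (2 * \<beta> - 1)) * \<dots>"
      using elim x by (meson mult_left_mono order_trans zero_le)
    also have "\<dots> = ennreal (C * x powr (2 * \<beta> - 1) *
        (\<rho> * (S * ?B0 * x powr (1 - 2 * \<beta> + q)) + \<sigma> * (S * ?B1 * x powr (1 - 2 * \<beta> + q - 1/2))))"
      using constants by (simp add: ennreal_mult')
    also have "C * x powr (2 * \<beta> - 1) *
        (\<rho> * (S * ?B0 * x powr (1 - 2 * \<beta> + q)) + \<sigma> * (S * ?B1 * x powr (1 - 2 * \<beta> + q - 1/2)))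
      = C * S * (\<rho> * ?B0 * (x powr (2 * \<beta> - 1) * x powr (1 - 2 * \<beta> + q))
         + \<sigma> * ?B1 * (x powr (2 * \<beta> - 1) * x powr (1 - 2 * \<beta> + q - 1/2)))"
      by (simp add: algebra_simps)
    also have "x powr (2 * \<beta> - 1) * x powr (1 - 2 * \<beta> + q) = x powr q"
      by (simp add: powr_add[symmetric])
    also have "x powr (2 * \<beta> - 1) * x powr (1 - 2 * \<beta> + q - 1/2) = x powr (-(1/2)) * x powr q"
      by (simp add: powr_add[symmetric])
    also have "C * S * (\<rho> * ?B0 * x powr q + \<sigma> * ?B1 * (x powr (-(1/2)) * x powr q))
      = C * S * (\<rho> * ?B0 + \<sigma> * x powr (-(1/2)) * ?B1) * x powr q"
      by (simp add: algebra_simps)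
    finally show "H x \<le> ennreal (C * S * (\<rho> * ?B0 + \<sigma> * x powr (-(1/2)) * ?B1) * x powr q)" .
  qed
qed

end

section \<open>Propagation of smallness to the right\<close>

context bounded_profile begin

text \<open>If \<open>H\<close> is small on \<open>(a, X)\<close>, then the rate at \<open>w\<close> is small for \<open>a < w < X / \<Lambda>\<close>, and at
  \<open>w < a\<close> it is at most \<open>M/\<alpha> \<le> M/\<alpha> * (a / w) powr (1/2)\<close>. Between \<open>\<Lambda> * a\<close> and \<open>X / \<Lambda>\<close> the upper bound is therefore a
  contraction in the norm with weight \<open>x powr (1/4)\<close>; before \<open>\<Lambda> * a\<close> the bound \<open>M\<close> suffices.
  Hence \<open>H\<close> decays like \<open>x powr (-1/4)\<close>.\<close>
lemma decay:
  assumes \<Lambda>: "1 \<le> \<Lambda>"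
    and absorb: "C * (2 * M / \<alpha> * \<Lambda> powr (-\<alpha>) * Beta (3/4 - \<beta>) (1 - \<beta>)
        + M / \<alpha> * \<Lambda> powr (-(1/2)) * Beta (3/4 - \<beta>) (1/2 - \<beta>)) \<le> 1/2"
    and a: "0 < a" and X: "0 < X"
    and small: "AE x in lborel. a < x \<longrightarrow> x < X \<longrightarrow> H x \<le> ennreal (M * \<Lambda> powr (-\<alpha>))"
  shows "AE x in lborel. 0 < x \<and> x < X / \<Lambda> \<longrightarrow>
    H x \<le> ennreal (2 * (M * (\<Lambda> * a) powr (1/4)) * x powr (-(1/4)))"
proof (rule AE_le_by_halving)
  show "AE x in lborel. 0 < x \<and> x < X / \<Lambda> \<longrightarrow> H x \<le> ennreal (M * (X / \<Lambda>) powr (1/4) * x powr (-(1/4)))"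
    using le_M
  proof eventually_elim
    case (elim x)
    show ?case
    proof
      assume x: "0 < x \<and> x < X / \<Lambda>"
      have "1 = x powr (1/4) * x powr (-(1/4))" using x by (simp add: powr_add[symmetric])
      also have "\<dots> \<le> (X / \<Lambda>) powr (1/4) * x powr (-(1/4))"
        using x by (intro mult_right_mono powr_mono2) auto
      finally have "M \<le> M * ((X / \<Lambda>) powr (1/4) * x powr (-(1/4)))" using M_pos by simp
      then show "H x \<le> ennreal (M * (X / \<Lambda>) powr (1/4) * x powr (-(1/4)))"
        using elim x by (auto elim!: order_trans intro!: ennreal_leI simp: mult.assoc)
    qed
  qed
  show "AE x in lborel. 0 < x \<and> x < X / \<Lambda> \<longrightarrow>
      H x \<le> ennreal ((M * (\<Lambda> * a) powr (1/4) + S / 2) * x powr (-(1/4)))"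
    if S: "0 \<le> S" and hyp: "AE x in lborel. 0 < x \<and> x < X / \<Lambda> \<longrightarrow> H x \<le> ennreal (S * x powr (-(1/4)))" for S
    using le_M upper_power
  proof eventually_elim
    case (elim x)
    show ?case
    proof
      assume x: "0 < x \<and> x < X / \<Lambda>"
      show "H x \<le> ennreal ((M * (\<Lambda> * a) powr (1/4) + S / 2) * x powr (-(1/4)))"
      proof (cases "x \<le> \<Lambda> * a")
        case True
        have "1 = x powr (1/4) * x powr (-(1/4))" using x by (simp add: powr_add[symmetric])
        also have "\<dots> \<le> (\<Lambda> * a) powr (1/4) * x powr (-(1/4))"
          using x True by (intro mult_right_mono powr_mono2) auto
        finally have "M \<le> M * ((\<Lambda> * a) powr (1/4) * x powr (-(1/4)))" using M_pos by simp
        also have "\<dots> \<le> (M * (\<Lambda> * a) powr (1/4) + S / 2) * x powr (-(1/4))"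
          using S by (simp add: algebra_simps)
        finally have "ennreal M \<le> ennreal ((M * (\<Lambda> * a) powr (1/4) + S / 2) * x powr (-(1/4)))"
          by (rule ennreal_leI)
        then show ?thesis using elim x by (auto elim: order_trans)
      next
        case False
        define \<rho> where "\<rho> = 2 * M / \<alpha> * \<Lambda> powr (-\<alpha>)"
        define \<sigma> where "\<sigma> = M / \<alpha> * a powr (1/2)"
        have pos: "0 \<le> \<rho>" "0 \<le> \<sigma>" using M_pos exponents by (auto simp: \<rho>_def \<sigma>_def)
        have rate: "tail_rate \<alpha> H w \<le> ennreal (\<rho> + \<sigma> * w powr (-(1/2)))" if w: "0 < w" "w < x" for w
        proof (cases "w < a")
          case True
          have "1 = w powr (1/2) * w powr (-(1/2))" using w by (simp add: powr_add[symmetric])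
          also have "\<dots> \<le> a powr (1/2) * w powr (-(1/2))"
            using w True by (intro mult_right_mono powr_mono2) auto
          finally have "M / \<alpha> * 1 \<le> M / \<alpha> * (a powr (1/2) * w powr (-(1/2)))"
            using M_pos exponents by (intro mult_left_mono) auto
          then have "M / \<alpha> \<le> \<rho> + \<sigma> * w powr (-(1/2))"
            using pos by (simp add: \<sigma>_def mult.assoc)
          then show ?thesis
            using tail_rate_le_M[OF w(1)] by (meson ennreal_leI order_trans)
        next
          case False
          have wX: "w \<le> X / \<Lambda>" using w x by simp
          also have "X / \<Lambda> \<le> X" using X \<Lambda> by (simp add: divide_le_eq)
          finally have "w \<le> X" .
          have "tail_rate \<alpha> H w \<le> ennreal (M * \<Lambda> powr (-\<alpha>) / \<alpha> + M / \<alpha> * (w / X) powr \<alpha>)"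
            using small w False M_pos \<open>w \<le> X\<close>
            by (intro tail_rate_split) (auto elim!: eventually_mono)
          also have "(w / X) powr \<alpha> \<le> \<Lambda> powr (-\<alpha>)"
          proof -
            have "(w / X) powr \<alpha> \<le> (1 / \<Lambda>) powr \<alpha>"
              using wX w X \<Lambda> exponents by (intro powr_mono2) (auto simp: field_simps)
            then show ?thesis using \<Lambda> by (simp add: powr_divide powr_minus_divide)
          qed
          then have "M * \<Lambda> powr (-\<alpha>) / \<alpha> + M / \<alpha> * (w / X) powr \<alpha> \<le> M * \<Lambda> powr (-\<alpha>) / \<alpha> + M / \<alpha> * \<Lambda> powr (-\<alpha>)"
            using M_pos exponents by (intro add_left_mono mult_left_mono) auto
          also have "\<dots> = \<rho>" by (simp add: \<rho>_def)
          also have "\<rho> \<le> \<rho> + \<sigma> * w powr (-(1/2))" using pos by simp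
          finally show ?thesis by (meson ennreal_leI order_trans \<open>tail_rate \<alpha> H w \<le> _\<close>)
        qed
        have "H x \<le> ennreal (C * S * (\<rho> * Beta (1 - \<beta> + -(1/4)) (1 - \<beta>)
            + \<sigma> * x powr (-(1/2)) * Beta (1 - \<beta> + -(1/4)) (1/2 - \<beta>)) * x powr (-(1/4)))"
        proof (rule elim(2)[rule_format])
          show "AE y in lborel. 0 < y \<longrightarrow> y < x \<longrightarrow> H y \<le> ennreal (S * y powr (-(1/4)))"
            using hyp x by (auto elim!: eventually_mono)
        qed (use x S pos rate in auto)
        also have "\<dots> \<le> ennreal ((M * (\<Lambda> * a) powr (1/4) + S / 2) * x powr (-(1/4)))"
        proof (intro ennreal_leI mult_right_mono)
          have B: "0 \<le> Beta (3/4 - \<beta>) (1/2 - \<beta>)" using exponents by (intro Beta_nonneg_real) auto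
          have "\<sigma> * x powr (-(1/2)) = M / \<alpha> * (a powr (1/2) * x powr (-(1/2)))"
            by (simp add: \<sigma>_def)
          also have "a powr (1/2) * x powr (-(1/2)) = (x / a) powr (-(1/2))"
            using x a by (simp add: powr_divide powr_minus_divide)
          also have "\<dots> \<le> \<Lambda> powr (-(1/2))"
            using False a \<Lambda> by (intro powr_mono2') (auto simp: field_simps)
          finally have \<sigma>: "\<sigma> * x powr (-(1/2)) \<le> M / \<alpha> * \<Lambda> powr (-(1/2))"
            using M_pos exponents by (simp add: divide_right_mono)
          have "C * S * (\<rho> * Beta (3/4 - \<beta>) (1 - \<beta>) + \<sigma> * x powr (-(1/2)) * Beta (3/4 - \<beta>) (1/2 - \<beta>))
            \<le> C * S * (\<rho> * Beta (3/4 - \<beta>) (1 - \<beta>) + M / \<alpha> * \<Lambda> powr (-(1/2)) * Beta (3/4 - \<beta>) (1/2 - \<beta>))"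
            using \<sigma> B S constants by (intro mult_left_mono add_left_mono mult_right_mono) auto
          also have "\<dots> = S * (C * (\<rho> * Beta (3/4 - \<beta>) (1 - \<beta>) + M / \<alpha> * \<Lambda> powr (-(1/2)) * Beta (3/4 - \<beta>) (1/2 - \<beta>)))"
            by (simp add: mult_ac)
          also have "\<dots> \<le> S * (1/2)"
            using absorb S unfolding \<rho>_def by (intro mult_left_mono)
          also have "\<dots> \<le> M * (\<Lambda> * a) powr (1/4) + S / 2" using M_pos by simp
          finally show "C * S * (\<rho> * Beta (1 - \<beta> + -(1/4)) (1 - \<beta>)
            + \<sigma> * x powr (-(1/2)) * Beta (1 - \<beta> + -(1/4)) (1/2 - \<beta>)) \<le> M * (\<Lambda> * a) powr (1/4) + S / 2"
            by (simp add: algebra_simps)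
        qed auto
        finally show ?thesis .
      qed
    qed
  qed
qed (use M_pos in auto)

text \<open>Beyond \<open>b\<close> only the rate \<open>M/\<alpha>\<close> is available, but \<open>H\<close> then grows at most like the power
  \<open>x powr q\<close>, where \<open>q\<close> is so large that the upper bound is a contraction in the corresponding
  weighted norm. The constant \<open>T\<close> bounds the contribution of \<open>(0, b)\<close>,
  relative to \<open>x powr q\<close>.\<close>
lemma growth:
  assumes b: "0 < b" "b < Y" and q: "0 \<le> q" and S': "0 \<le> S'"
    and absorb: "C * (M / \<alpha>) * Beta (1 - \<beta> + q) (1 - \<beta>) \<le> 1/2"
    and start: "AE x in lborel. 0 < x \<and> x < b \<longrightarrow> H x \<le> ennreal (S' * x powr (-(1/4)))"
  defines "T \<equiv> C * (M / \<alpha>) * Beta (3/4 - \<beta>) (1 - \<beta>) * S' * b powr (-(1/4) - q)"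
  shows "AE x in lborel. b < x \<and> x < Y \<longrightarrow> H x \<le> ennreal (2 * T * x powr q)"
proof -
  have B: "0 \<le> Beta (3/4 - \<beta>) (1 - \<beta>)" "0 \<le> Beta (1 - \<beta> + q) (1 - \<beta>)"
    using exponents q by (auto intro!: Beta_nonneg_real)
  have T: "0 \<le> T" unfolding T_def using S' B M_pos exponents constants by simp
  have upper': "AE x in lborel. 0 < x \<longrightarrow> H x \<le> ennreal (C * (M / \<alpha>) * x powr (2 * \<beta> - 1)) *
      (\<integral>\<^sup>+y\<in>{0<..<x}. ennreal (y powr (-\<beta>) * (x - y) powr (-\<beta>)) * H y \<partial>lborel)"
    using M_pos exponents by (intro upper_const_rate tail_rate_le_M) auto
  show ?thesis
  proof (rule AE_le_by_halving)
    show "AE x in lborel. b < x \<and> x < Y \<longrightarrow> H x \<le> ennreal (M * b powr (-q) * x powr q)"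
      using le_M
    proof eventually_elim
      case (elim x)
      show ?case
      proof
        assume x: "b < x \<and> x < Y"
        have "1 = b powr (-q) * b powr q" using b by (simp add: powr_add[symmetric])
        also have "\<dots> \<le> b powr (-q) * x powr q"
          using x b q by (intro mult_left_mono powr_mono2) auto
        finally have "M \<le> M * (b powr (-q) * x powr q)" using M_pos by simp
        then show "H x \<le> ennreal (M * b powr (-q) * x powr q)"
          using elim x b by (auto elim!: order_trans intro!: ennreal_leI simp: mult.assoc)
      qed
    qed
    show "AE x in lborel. b < x \<and> x < Y \<longrightarrow> H x \<le> ennreal ((T + S / 2) * x powr q)"
      if S: "0 \<le> S" and hyp: "AE x in lborel. b < x \<and> x < Y \<longrightarrow> H x \<le> ennreal (S * x powr q)" for S
      using upper'
    proof eventually_elim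
      case (elim x)
      show ?case
      proof
        assume x: "b < x \<and> x < Y"
        then have x0: "0 < x" using b by simp
        let ?J = "\<lambda>F. \<integral>\<^sup>+y\<in>{0<..<x}. ennreal (y powr (-\<beta>) * (x - y) powr (-\<beta>)) * F y \<partial>lborel"
        have "?J H \<le> (\<integral>\<^sup>+y. ennreal (y powr (-\<beta>) * (x - y) powr (-\<beta>)) * ennreal (S * y powr q) * indicator {0<..<x} y
            + ennreal (y powr (-\<beta>) * (x - y) powr (-\<beta>)) * ennreal (S' * y powr (-(1/4))) * indicator {0<..<x} y \<partial>lborel)"
        proof (rule nn_integral_mono_AE)
          show "AE y in lborel. ennreal (y powr (-\<beta>) * (x - y) powr (-\<beta>)) * H y * indicator {0<..<x} y \<le>
            ennreal (y powr (-\<beta>) * (x - y) powr (-\<beta>)) * ennreal (S * y powr q) * indicator {0<..<x} y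
            + ennreal (y powr (-\<beta>) * (x - y) powr (-\<beta>)) * ennreal (S' * y powr (-(1/4))) * indicator {0<..<x} y"
            using hyp start AE_lborel_singleton[of b]
          proof eventually_elim
            case (elim y)
            have "H y \<le> ennreal (S * y powr q) + ennreal (S' * y powr (-(1/4)))" if "0 < y" "y < x"
            proof (cases "y < b")
              case True
              then show ?thesis using elim that by (simp add: add_increasing)
            next
              case False
              then show ?thesis using elim that x by (simp add: add_increasing2)
            qed
            then show ?case
              by (auto simp: indicator_def distrib_left[symmetric] intro!: mult_left_mono)
          qed
        qed
        also have "\<dots> = ?J (\<lambda>y. ennreal (S * y powr q)) + ?J (\<lambda>y. ennreal (S' * y powr (-(1/4))))"
          by (rule nn_integral_add) measurable
        also have "\<dots> \<le> ennreal (S * Beta (1 - (\<beta> - q)) (1 - \<beta>) * x powr (1 - (\<beta> - q) - \<beta>))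
            + ennreal (S' * Beta (1 - (\<beta> - -(1/4))) (1 - \<beta>) * x powr (1 - (\<beta> - -(1/4)) - \<beta>))"
          using S S' x0 exponents q by (intro add_mono abel_integral_le) auto
        also have "\<dots> = ennreal (S * Beta (1 - \<beta> + q) (1 - \<beta>) * x powr (1 - 2 * \<beta> + q)
            + S' * Beta (3/4 - \<beta>) (1 - \<beta>) * x powr (1 - 2 * \<beta> + -(1/4)))"
          using S S' B by (subst ennreal_plus[symmetric]) (auto simp: algebra_simps)
        finally have "H x \<le> ennreal (C * (M / \<alpha>) * x powr (2 * \<beta> - 1)) * \<dots>"
          using elim x0 by (meson mult_left_mono order_trans zero_le)
        also have "\<dots> = ennreal (C * (M / \<alpha>) * x powr (2 * \<beta> - 1) *
            (S * Beta (1 - \<beta> + q) (1 - \<beta>) * x powr (1 - 2 * \<beta> + q)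
            + S' * Beta (3/4 - \<beta>) (1 - \<beta>) * x powr (1 - 2 * \<beta> + -(1/4))))"
          using constants M_pos exponents by (simp add: ennreal_mult'[symmetric])
        also have "\<dots> \<le> ennreal ((T + S / 2) * x powr q)"
        proof (rule ennreal_leI)
          have "C * (M / \<alpha>) * x powr (2 * \<beta> - 1) *
            (S * Beta (1 - \<beta> + q) (1 - \<beta>) * x powr (1 - 2 * \<beta> + q)
            + S' * Beta (3/4 - \<beta>) (1 - \<beta>) * x powr (1 - 2 * \<beta> + -(1/4)))
            = C * (M / \<alpha>) * Beta (1 - \<beta> + q) (1 - \<beta>) * S * (x powr (2 * \<beta> - 1) * x powr (1 - 2 * \<beta> + q))
            + C * (M / \<alpha>) * Beta (3/4 - \<beta>) (1 - \<beta>) * S' * (x powr (2 * \<beta> - 1) * x powr (1 - 2 * \<beta> + -(1/4)))"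
            by (simp add: algebra_simps)
          also have "x powr (2 * \<beta> - 1) * x powr (1 - 2 * \<beta> + q) = x powr q"
            by (simp add: powr_add[symmetric])
          also have "x powr (2 * \<beta> - 1) * x powr (1 - 2 * \<beta> + -(1/4)) = x powr (-(1/4) - q) * x powr q"
            by (simp add: powr_add[symmetric])
          also have "C * (M / \<alpha>) * Beta (1 - \<beta> + q) (1 - \<beta>) * S * x powr q \<le> 1/2 * S * x powr q"
            using absorb S by (intro mult_right_mono) auto
          also have "C * (M / \<alpha>) * Beta (3/4 - \<beta>) (1 - \<beta>) * S' * (x powr (-(1/4) - q) * x powr q)
            \<le> C * (M / \<alpha>) * Beta (3/4 - \<beta>) (1 - \<beta>) * S' * (b powr (-(1/4) - q) * x powr q)"
            using x b q S' B M_pos exponents constants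
            by (intro mult_left_mono mult_right_mono powr_mono2') auto
          also have "1/2 * S * x powr q + \<dots> = (T + S / 2) * x powr q"
            by (simp add: T_def algebra_simps)
          finally show "C * (M / \<alpha>) * x powr (2 * \<beta> - 1) *
            (S * Beta (1 - \<beta> + q) (1 - \<beta>) * x powr (1 - 2 * \<beta> + q)
            + S' * Beta (3/4 - \<beta>) (1 - \<beta>) * x powr (1 - 2 * \<beta> + -(1/4))) \<le> (T + S / 2) * x powr q"
            by simp
        qed
        finally show "H x \<le> ennreal ((T + S / 2) * x powr q)" .
      qed
    qed
  qed (use T M_pos in auto)
qed

text \<open>Decay from \<open>a\<close> to \<open>X / \<Lambda>\<close> gains a power of \<open>a / X\<close>, growth from \<open>X / \<Lambda>\<close> to \<open>2 * X\<close> costs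
  the fixed factor \<open>(2 * \<Lambda>) powr q\<close>. Hence smallness on an interval of sufficiently large
  ratio \<open>N\<close> propagates to the right with the same constant.\<close>
lemma doubling:
  assumes \<Lambda>: "1 \<le> \<Lambda>" and q: "0 \<le> q" and N: "0 < N"
    and absorb1: "C * (2 * M / \<alpha> * \<Lambda> powr (-\<alpha>) * Beta (3/4 - \<beta>) (1 - \<beta>)
        + M / \<alpha> * \<Lambda> powr (-(1/2)) * Beta (3/4 - \<beta>) (1/2 - \<beta>)) \<le> 1/2"
    and absorb2: "C * (M / \<alpha>) * Beta (1 - \<beta> + q) (1 - \<beta>) \<le> 1/2"
    and gap: "4 * C * M\<^sup>2 / \<alpha> * Beta (3/4 - \<beta>) (1 - \<beta>) * (2 * \<Lambda>) powr q * (\<Lambda>\<^sup>2 / N) powr (1/4) \<le> M * \<Lambda> powr (-\<alpha>)"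
    and a: "0 < a" and X: "N * a \<le> X" "\<Lambda> * a < X"
    and small: "AE x in lborel. a < x \<longrightarrow> x < X \<longrightarrow> H x \<le> ennreal (M * \<Lambda> powr (-\<alpha>))"
  shows "AE x in lborel. a < x \<longrightarrow> x < 2 * X \<longrightarrow> H x \<le> ennreal (M * \<Lambda> powr (-\<alpha>))"
proof -
  have X0: "0 < X" using N a X by (meson less_le_trans mult_pos_pos)
  have B: "0 \<le> Beta (3/4 - \<beta>) (1 - \<beta>)" using exponents by (intro Beta_nonneg_real) auto
  define b where "b = X / \<Lambda>"
  have b: "0 < b" "b \<le> X" "a < b" using X0 \<Lambda> X by (auto simp: b_def field_simps)
  define S' where "S' = 2 * (M * (\<Lambda> * a) powr (1/4))"
  have S': "0 \<le> S'" using M_pos by (simp add: S'_def)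
  have "AE x in lborel. 0 < x \<and> x < b \<longrightarrow> H x \<le> ennreal (S' * x powr (-(1/4)))"
    unfolding b_def S'_def by (rule decay) (use assms X0 in auto)
  then have G: "AE x in lborel. b < x \<and> x < 2 * X \<longrightarrow>
      H x \<le> ennreal (2 * (C * (M / \<alpha>) * Beta (3/4 - \<beta>) (1 - \<beta>) * S' * b powr (-(1/4) - q)) * x powr q)"
    using b q S' absorb2 by (intro growth) auto
  have bound: "2 * (C * (M / \<alpha>) * Beta (3/4 - \<beta>) (1 - \<beta>) * S' * b powr (-(1/4) - q)) * x powr q \<le> M * \<Lambda> powr (-\<alpha>)"
    if x: "b < x" "x < 2 * X" for x
  proof -
    have "2 * (C * (M / \<alpha>) * Beta (3/4 - \<beta>) (1 - \<beta>) * S' * b powr (-(1/4) - q)) * x powr q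
      \<le> 2 * (C * (M / \<alpha>) * Beta (3/4 - \<beta>) (1 - \<beta>) * S' * b powr (-(1/4) - q)) * (2 * X) powr q"
      using x b q S' B M_pos exponents constants by (intro mult_left_mono powr_mono2) auto
    also have "\<dots> = 4 * C * M\<^sup>2 / \<alpha> * Beta (3/4 - \<beta>) (1 - \<beta>) *
        (((2 * X) powr q * b powr (-q)) * ((\<Lambda> * a) powr (1/4) * b powr (-(1/4))))"
    proof -
      have "b powr (-(1/4) - q) = b powr (-q) * b powr (-(1/4))"
        using powr_add[of b "-(1/4)" "-q"] by simp
      then show ?thesis by (simp add: S'_def power2_eq_square)
    qed
    also have "(2 * X) powr q * b powr (-q) = (2 * \<Lambda>) powr q"
    proof -
      have "2 * X = (2 * \<Lambda>) * b" using \<Lambda> by (simp add: b_def)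
      then have "(2 * X) powr q = (2 * \<Lambda>) powr q * b powr q" by (simp add: powr_mult)
      then show ?thesis using b by (simp add: powr_minus)
    qed
    also have "4 * C * M\<^sup>2 / \<alpha> * Beta (3/4 - \<beta>) (1 - \<beta>) *
        ((2 * \<Lambda>) powr q * ((\<Lambda> * a) powr (1/4) * b powr (-(1/4))))
      \<le> 4 * C * M\<^sup>2 / \<alpha> * Beta (3/4 - \<beta>) (1 - \<beta>) * ((2 * \<Lambda>) powr q * (\<Lambda>\<^sup>2 / N) powr (1/4))"
    proof (intro mult_left_mono)
      have "(\<Lambda> * a) powr (1/4) * b powr (-(1/4)) = ((\<Lambda> * a) / b) powr (1/4)"
        using b \<Lambda> a by (simp add: powr_divide powr_minus_divide)
      also have "(\<Lambda> * a) / b = \<Lambda>\<^sup>2 * a / X"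
        using \<Lambda> X0 by (simp add: b_def power2_eq_square)
      also have "(\<Lambda>\<^sup>2 * a / X) powr (1/4) \<le> (\<Lambda>\<^sup>2 / N) powr (1/4)"
      proof (rule powr_mono2)
        have "\<Lambda>\<^sup>2 * (N * a) \<le> \<Lambda>\<^sup>2 * X" using X by (intro mult_left_mono) auto
        then show "\<Lambda>\<^sup>2 * a / X \<le> \<Lambda>\<^sup>2 / N" using X0 N by (simp add: field_simps)
      qed (use a X0 in auto)
      finally show "(\<Lambda> * a) powr (1/4) * b powr (-(1/4)) \<le> (\<Lambda>\<^sup>2 / N) powr (1/4)" .
    qed (use B M_pos exponents constants in auto)
    also have "\<dots> \<le> M * \<Lambda> powr (-\<alpha>)"
      using gap by (simp only: mult.assoc)
    finally show ?thesis .
  qed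
  show ?thesis
    using small G AE_lborel_singleton[of b]
  proof eventually_elim
    case (elim x)
    show ?case
    proof (intro impI)
      assume x: "a < x" "x < 2 * X"
      show "H x \<le> ennreal (M * \<Lambda> powr (-\<alpha>))"
      proof (cases "x < b")
        case True
        then show ?thesis using elim(1) x b by auto
      next
        case False
        then have "b < x" using elim(3) by auto
        then show ?thesis using elim(2) bound x by (meson ennreal_leI order_trans)
      qed
    qed
  qed
qed

lemma small_forever:
  assumes \<Lambda>: "1 \<le> \<Lambda>" and q: "0 \<le> q" and N: "\<Lambda> < N"
    and absorb1: "C * (2 * M / \<alpha> * \<Lambda> powr (-\<alpha>) * Beta (3/4 - \<beta>) (1 - \<beta>)
        + M / \<alpha> * \<Lambda> powr (-(1/2)) * Beta (3/4 - \<beta>) (1/2 - \<beta>)) \<le> 1/2"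
    and absorb2: "C * (M / \<alpha>) * Beta (1 - \<beta> + q) (1 - \<beta>) \<le> 1/2"
    and gap: "4 * C * M\<^sup>2 / \<alpha> * Beta (3/4 - \<beta>) (1 - \<beta>) * (2 * \<Lambda>) powr q * (\<Lambda>\<^sup>2 / N) powr (1/4) \<le> M * \<Lambda> powr (-\<alpha>)"
    and a: "0 < a"
    and small: "AE x in lborel. a < x \<longrightarrow> x < N * a \<longrightarrow> H x \<le> ennreal (M * \<Lambda> powr (-\<alpha>))"
  shows "AE x in lborel. a < x \<longrightarrow> H x \<le> ennreal (M * \<Lambda> powr (-\<alpha>))"
proof -
  have N0: "0 < N" "\<Lambda> * a < N * a" using \<Lambda> N a by auto
  have "AE x in lborel. a < x \<longrightarrow> x < 2 ^ n * (N * a) \<longrightarrow> H x \<le> ennreal (M * \<Lambda> powr (-\<alpha>))" for n :: nat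
  proof (induction n)
    case 0
    then show ?case using small by simp
  next
    case (Suc n)
    have le: "N * a \<le> 2 ^ n * (N * a)" using N0 a by simp
    have "AE x in lborel. a < x \<longrightarrow> x < 2 * (2 ^ n * (N * a)) \<longrightarrow> H x \<le> ennreal (M * \<Lambda> powr (-\<alpha>))"
      by (rule doubling[OF \<Lambda> q N0(1) absorb1 absorb2 gap a le less_le_trans[OF N0(2) le] Suc.IH])
    then show ?case by (simp add: mult_ac)
  qed
  then have "AE x in lborel. \<forall>n::nat. a < x \<longrightarrow> x < 2 ^ n * (N * a) \<longrightarrow> H x \<le> ennreal (M * \<Lambda> powr (-\<alpha>))"
    by (subst AE_all_countable) blast
  then show ?thesis
  proof eventually_elim
    case (elim x)
    have Na: "0 < N * a" using N0 a by simp
    obtain n :: nat where "x / (N * a) < 2 ^ n" using real_arch_pow[of 2] by auto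
    then have "x < 2 ^ n * (N * a)" using Na by (simp add: pos_divide_less_eq)
    then show ?case using elim by blast
  qed
qed

text \<open>If \<open>H\<close> is small on the whole half-line, so is the rate; the upper bound is then a contraction in the
  supremum norm and forces \<open>H = 0\<close>.\<close>
lemma not_small_everywhere:
  assumes \<delta>: "0 \<le> \<delta>" "C * (\<delta> / \<alpha>) * Beta (1 - \<beta>) (1 - \<beta>) \<le> 1/2"
    and small: "AE x in lborel. 0 < x \<longrightarrow> H x \<le> ennreal \<delta>"
  shows False
proof -
  have "AE x in lborel. 0 < x \<longrightarrow> H x \<le> ennreal (2 * 0 * 1)"
  proof (rule AE_le_by_halving)
    show "AE x in lborel. 0 < x \<longrightarrow> H x \<le> ennreal (\<delta> * 1)" using small by simp
    show "AE x in lborel. 0 < x \<longrightarrow> H x \<le> ennreal ((0 + S / 2) * 1)"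
      if S: "0 \<le> S" and hyp: "AE x in lborel. 0 < x \<longrightarrow> H x \<le> ennreal (S * 1)" for S
      using upper_power
    proof eventually_elim
      case (elim x)
      show ?case
      proof
        assume x: "0 < x"
        have "H x \<le> ennreal (C * S * (\<delta> / \<alpha> * Beta (1 - \<beta> + 0) (1 - \<beta>)
            + 0 * x powr (-(1/2)) * Beta (1 - \<beta> + 0) (1/2 - \<beta>)) * x powr 0)"
        proof (rule elim[rule_format])
          show "tail_rate \<alpha> H w \<le> ennreal (\<delta> / \<alpha> + 0 * w powr (-(1/2)))" if "0 < w" for w
          proof -
            have "AE x in lborel. w < x \<longrightarrow> H x \<le> ennreal \<delta>"
              using small that by (auto elim!: eventually_mono)
            then show ?thesis using tail_rate_le_const[of w \<delta>] that \<delta> by simp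
          qed
          show "AE y in lborel. 0 < y \<longrightarrow> y < x \<longrightarrow> H y \<le> ennreal (S * y powr 0)"
            using hyp by (auto elim!: eventually_mono)
        qed (use x S \<delta> exponents in auto)
        also have "\<dots> \<le> ennreal ((0 + S / 2) * 1)"
          using x mult_left_mono[OF \<delta>(2) S] by (intro ennreal_leI) (simp add: mult_ac)
        finally show "H x \<le> ennreal ((0 + S / 2) * 1)" .
      qed
    qed
  qed (use \<delta> in auto)
  with positive have "AE x in lborel. \<not> 0 < (x::real)"
    by eventually_elim auto
  from AE_lborel_Ioo_witness[OF this, of 0 1] show False by auto
qed

end

section \<open>Propagation of smallness to the left\<close>

text \<open>Smallness propagates to the left. By the lower bound \<open>H x\<close> dominates the square of the average over
  \<open>(2/3 * x, x)\<close>; if that is small, then \<open>H\<close> is small at some point \<open>x1 < 5/6 * x\<close>, from which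
  the argument is repeated. The value \<open>R = 4/3 * x\<close> is used in the lower bound.\<close>
lemma small_value_small_mass:
  assumes "0 < c" "0 < e"
  shows "\<exists>m>0. \<forall>H. profile_bounds \<alpha> \<beta> c C H \<longrightarrow>
    (AE x in lborel. 0 < x \<longrightarrow> H x \<le> ennreal m \<longrightarrow> mass H ((5/6) ^ k * x) x \<le> ennreal (e * x))"
  using assms(2)
proof (induction k arbitrary: e)
  case 0
  show ?case by (intro exI[of _ 1]) (auto simp: mass_def)
next
  case (Suc k)
  obtain m' where m': "0 < m'" "\<And>H. profile_bounds \<alpha> \<beta> c C H \<Longrightarrow>
    (AE x in lborel. 0 < x \<longrightarrow> H x \<le> ennreal m' \<longrightarrow> mass H ((5/6) ^ k * x) x \<le> ennreal (e / 2 * x))"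
    using Suc.IH[of "e / 2"] Suc.prems by auto
  \<comment> \<open>\<open>(2/3 * x, 5/6 * x)\<close> has length \<open>x / 6\<close>; if \<open>H \<ge> 12 * s\<close> there, the mass
    exceeds \<open>s * x\<close>.\<close>
  define s where "s = min (m' / 12) (e / 2)"
  have s: "0 < s" "12 * s \<le> m'" "s \<le> e / 2" using m' Suc.prems by (auto simp: s_def)
  define m where "m = c * s\<^sup>2 / 2"
  have m: "0 < m" using s assms by (simp add: m_def)
  have "AE x in lborel. 0 < x \<longrightarrow> H x \<le> ennreal m \<longrightarrow> mass H ((5/6) ^ Suc k * x) x \<le> ennreal (e * x)"
    if "profile_bounds \<alpha> \<beta> c C H" for H
  proof -
    interpret profile_bounds \<alpha> \<beta> c C H by fact
    have IH: "AE x in lborel. 0 < x \<longrightarrow> H x \<le> ennreal m' \<longrightarrow> mass H ((5/6) ^ k * x) x \<le> ennreal (e / 2 * x)"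
      by (rule m') fact
    show ?thesis
      using lower
    proof eventually_elim
      case (elim x)
      show ?case
      proof (intro impI)
        assume x: "0 < x" "H x \<le> ennreal m"
        define G where "G = mass H (2/3 * x) x"
        have G: "G \<le> ennreal (s * x)"
        proof (rule ccontr)
          assume "\<not> ?thesis"
          then have "ennreal (s * x) \<le> G" by simp
          have "ennreal (c / (4/3 * x)\<^sup>2) * (ennreal (s * x) * ennreal (s * x))
            \<le> ennreal (c / (4/3 * x)\<^sup>2) * (mass H (4/3 * x / 2) x * mass H (4/3 * x / 2) (2 * (4/3 * x)))"
          proof (intro mult_left_mono mult_mono)
            show "ennreal (s * x) \<le> mass H (4/3 * x / 2) x" using \<open>_ \<le> G\<close> by (simp add: G_def)
            then show "ennreal (s * x) \<le> mass H (4/3 * x / 2) (2 * (4/3 * x))"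
              using x by (auto elim!: order_trans intro!: mass_mono)
          qed auto
          also have "\<dots> \<le> H x" using x by (intro elim[rule_format]) auto
          also have "\<dots> \<le> ennreal m" by fact
          also have "ennreal (c / (4/3 * x)\<^sup>2) * (ennreal (s * x) * ennreal (s * x)) = ennreal (9/16 * (c * s\<^sup>2))"
            using x s assms by (simp add: ennreal_mult'[symmetric] power2_eq_square field_simps)
          finally show False using m s assms by (simp add: m_def)
        qed
        obtain x1 where x1: "2/3 * x < x1" "x1 < 5/6 * x" "H x1 \<le> ennreal m'"
          "mass H ((5/6) ^ k * x1) x1 \<le> ennreal (e / 2 * x1)"
        proof -
          have "\<exists>x1. 2/3 * x < x1 \<and> x1 < 5/6 * x \<and> H x1 \<le> ennreal m' \<and>
             mass H ((5/6) ^ k * x1) x1 \<le> ennreal (e / 2 * x1)"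
          proof (rule ccontr)
            assume none: "\<not> ?thesis"
            have "AE y in lborel. 2/3 * x < y \<longrightarrow> y < 5/6 * x \<longrightarrow> ennreal (12 * s) \<le> H y"
              using IH
            proof eventually_elim
              case (elim y)
              show ?case
              proof (intro impI, rule ccontr)
                assume y: "2/3 * x < y" "y < 5/6 * x" "\<not> ennreal (12 * s) \<le> H y"
                then have "H y \<le> ennreal m'" using s by (meson ennreal_leI le_cases order_trans)
                then show False using none elim y x by auto
              qed
            qed
            then have "ennreal (12 * s) * ennreal (5/6 * x - 2/3 * x) \<le> mass H (2/3 * x) (5/6 * x)"
              using x by (intro mass_ge) auto
            also have "\<dots> \<le> G" unfolding G_def using x by (intro mass_mono) auto
            also note G
            also have "ennreal (12 * s) * ennreal (5/6 * x - 2/3 * x) = ennreal (2 * s * x)"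
              using s x by (subst ennreal_mult'[symmetric]) auto
            finally show False using s x by (simp add: ennreal_le_iff)
          qed
          then show ?thesis using that by blast
        qed
        have "mass H ((5/6) ^ Suc k * x) x \<le> mass H ((5/6) ^ Suc k * x) x1 + mass H x1 x"
          by (rule mass_subadditive) simp
        also have "mass H x1 x \<le> mass H (2/3 * x) x"
          using x1 by (intro mass_mono) auto
        also have "mass H ((5/6) ^ Suc k * x) x1 \<le> mass H ((5/6) ^ k * x1) x1"
          using x1 by (intro mass_mono) (auto simp: field_simps)
        also note x1(4)
        also have "ennreal (e / 2 * x1) \<le> ennreal (e / 2 * x)"
          using x1 x Suc.prems by (intro ennreal_leI mult_left_mono) auto
        also have "ennreal (e / 2 * x) + mass H (2/3 * x) x \<le> ennreal (e / 2 * x) + ennreal (s * x)"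
          using G by (intro add_left_mono) (simp add: G_def)
        also have "\<dots> = ennreal (e / 2 * x + s * x)"
          using x s Suc.prems by (subst ennreal_plus) auto
        also have "\<dots> \<le> ennreal (e * x)"
          using mult_right_mono[of s "e/2" x] s x by (intro ennreal_leI) (simp add: field_simps)
        finally show "mass H ((5/6) ^ Suc k * x) x \<le> ennreal (e * x)"
          by (auto simp: add_left_mono add_right_mono)
      qed
    qed
  qed
  with m show ?case by blast
qed

text \<open>The part of \<open>(0, x)\<close> left of \<open>(5/6) ^ k * x\<close> is short, and \<open>H \<le> M\<close> there.\<close>
lemma small_value_small_average:
  assumes "0 < c" "0 < e" "0 < M"
  shows "\<exists>m>0. \<forall>H. bounded_profile \<alpha> \<beta> c C H M \<longrightarrow>
    (AE x in lborel. 0 < x \<longrightarrow> H x \<le> ennreal m \<longrightarrow> mass H 0 x \<le> ennreal (e * x))"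
proof -
  obtain k :: nat where k: "(5/6) ^ k < e / (2 * M)"
    using real_arch_pow_inv[of "e / (2 * M)" "5/6"] assms by auto
  obtain m where m: "0 < m" "\<And>H. profile_bounds \<alpha> \<beta> c C H \<Longrightarrow>
    (AE x in lborel. 0 < x \<longrightarrow> H x \<le> ennreal m \<longrightarrow> mass H ((5/6) ^ k * x) x \<le> ennreal (e / 2 * x))"
    using small_value_small_mass[of c "e / 2" \<alpha> \<beta> C k] assms by auto
  have "AE x in lborel. 0 < x \<longrightarrow> H x \<le> ennreal m \<longrightarrow> mass H 0 x \<le> ennreal (e * x)"
    if "bounded_profile \<alpha> \<beta> c C H M" for H
  proof -
    interpret bounded_profile \<alpha> \<beta> c C H M by fact
    have "profile_bounds \<alpha> \<beta> c C H" by unfold_locales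
    from m(2)[OF this] show ?thesis
    proof eventually_elim
      case (elim x)
      show ?case
      proof (intro impI)
        assume x: "0 < x" "H x \<le> ennreal m"
        have "mass H 0 x \<le> mass H 0 ((5/6) ^ k * x) + mass H ((5/6) ^ k * x) x"
          by (rule mass_subadditive) simp
        also have "mass H 0 ((5/6) ^ k * x) \<le> ennreal M * ennreal ((5/6) ^ k * x - 0)"
          using x le_M by (intro mass_le) (auto elim!: eventually_mono)
        also have "\<dots> = ennreal (M * (5/6) ^ k * x)"
          using M_pos by (simp add: ennreal_mult'[symmetric] mult.assoc)
        also have "\<dots> \<le> ennreal (e / 2 * x)"
          using k x M_pos by (intro ennreal_leI mult_right_mono) (auto simp: field_simps)
        also have "ennreal (e / 2 * x) + mass H ((5/6) ^ k * x) x \<le> ennreal (e / 2 * x) + ennreal (e / 2 * x)"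
          using elim x by (intro add_left_mono) auto
        also have "\<dots> = ennreal (e * x)"
          using assms x by (subst ennreal_plus[symmetric]) auto
        finally show "mass H 0 x \<le> ennreal (e * x)" by (auto simp: add_right_mono)
      qed
    qed
  qed
  with m show ?thesis by blast
qed

text \<open>Small averages yield small values, because the convolution regularises: the singular kernel \<open>k\<close> is
  at most \<open>L + k * k / L\<close>, where the constant is integrated against the small average and the square,
  still integrable as \<open>2 * \<beta> < 1\<close>, against \<open>M\<close>. The parameter \<open>l\<close> is \<open>L\<close> made dimensionless.\<close>
lemma (in bounded_profile) small_average_small_nearby:
  assumes l: "0 < l" and N: "0 < N" and e: "0 \<le> e" and avg: "mass H 0 x0 \<le> ennreal (e * x0)"
  shows "AE x in lborel. 0 < x \<longrightarrow> x0 / N < x \<longrightarrow> x < x0 \<longrightarrow>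
    H x \<le> ennreal (C * (M / \<alpha>) * (l * N * e + M * Beta (1 - 2 * \<beta>) (1 - 2 * \<beta>) / l))"
proof -
  have B: "0 \<le> Beta (1 - 2 * \<beta>) (1 - 2 * \<beta>)" using exponents by (intro Beta_nonneg_real) auto
  have "AE x in lborel. 0 < x \<longrightarrow> H x \<le> ennreal (C * (M / \<alpha>) * x powr (2 * \<beta> - 1)) *
      (\<integral>\<^sup>+y\<in>{0<..<x}. ennreal (y powr (-\<beta>) * (x - y) powr (-\<beta>)) * H y \<partial>lborel)"
    using M_pos exponents by (intro upper_const_rate tail_rate_le_M) auto
  then show ?thesis
  proof eventually_elim
    case (elim x)
    show ?case
    proof (intro impI)
      assume x: "0 < x" "x0 / N < x" "x < x0"
      define L where "L = l * x powr (-(2 * \<beta>))"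
      have L: "0 < L" using x l by (simp add: L_def)
      have "(\<integral>\<^sup>+y\<in>{0<..<x}. ennreal (y powr (-\<beta>) * (x - y) powr (-\<beta>)) * H y \<partial>lborel)
        \<le> (\<integral>\<^sup>+y. ennreal L * (H y * indicator {0<..<x} y)
          + ennreal (1 / L) * (ennreal (y powr (-(2 * \<beta>)) * (x - y) powr (-(2 * \<beta>))) * H y * indicator {0<..<x} y) \<partial>lborel)"
      proof (rule nn_integral_mono)
        fix y
        show "ennreal (y powr (-\<beta>) * (x - y) powr (-\<beta>)) * H y * indicator {0<..<x} y
          \<le> ennreal L * (H y * indicator {0<..<x} y)
          + ennreal (1 / L) * (ennreal (y powr (-(2 * \<beta>)) * (x - y) powr (-(2 * \<beta>))) * H y * indicator {0<..<x} y)"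
        proof (cases "y \<in> {0<..<x}")
          case True
          define k where "k = y powr (-\<beta>) * (x - y) powr (-\<beta>)"
          have k: "0 \<le> k" by (simp add: k_def)
          have k2: "y powr (-(2 * \<beta>)) * (x - y) powr (-(2 * \<beta>)) = k * k"
          proof -
            have "k * k = (y powr (-\<beta>) * y powr (-\<beta>)) * ((x - y) powr (-\<beta>) * (x - y) powr (-\<beta>))"
              by (simp add: k_def mult_ac)
            also have "\<dots> = y powr (-(2 * \<beta>)) * (x - y) powr (-(2 * \<beta>))"
              by (simp add: powr_add[symmetric])
            finally show ?thesis ..
          qed
          have "k \<le> L + 1 / L * (k * k)"
          proof (cases "k \<le> L")
            case True
            then show ?thesis using L k by (simp add: add_increasing2)
          next
            case False
            then have "L * k \<le> k * k" using k by (intro mult_right_mono) auto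
            then have "k \<le> 1 / L * (k * k)" using L by (simp add: field_simps)
            then show ?thesis using L by linarith
          qed
          then have "ennreal k * H y \<le> ennreal (L + 1 / L * (k * k)) * H y"
            by (intro mult_right_mono ennreal_leI) auto
          also have "\<dots> = ennreal L * H y + ennreal (1 / L) * (ennreal (k * k) * H y)"
          proof -
            have "ennreal (L + 1 / L * (k * k)) = ennreal L + ennreal (1 / L * (k * k))"
              using L k by (intro ennreal_plus) auto
            also have "ennreal (1 / L * (k * k)) = ennreal (1 / L) * ennreal (k * k)"
              using L by (intro ennreal_mult') auto
            finally show ?thesis by (simp only: distrib_right mult.assoc)
          qed
          finally show ?thesis using True unfolding k_def[symmetric] k2 by simp
        qed auto
      qed
      also have "\<dots> = ennreal L * mass H 0 x + ennreal (1 / L) *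
          (\<integral>\<^sup>+y\<in>{0<..<x}. ennreal (y powr (-(2 * \<beta>)) * (x - y) powr (-(2 * \<beta>))) * H y \<partial>lborel)"
        unfolding mass_def by (rule nn_integral_linear_combination) measurable
      also have "\<dots> \<le> ennreal L * ennreal (e * (N * x)) + ennreal (1 / L) *
          ennreal (M * Beta (1 - 2 * \<beta>) (1 - 2 * \<beta>) * x powr (1 - 2 * \<beta> - 2 * \<beta>))"
      proof (intro add_mono mult_left_mono abel_integral_le)
        have "mass H 0 x \<le> mass H 0 x0" using x by (intro mass_mono) auto
        also note avg
        also have "ennreal (e * x0) \<le> ennreal (e * (N * x))"
          using x N e by (intro ennreal_leI mult_left_mono) (auto simp: field_simps)
        finally show "mass H 0 x \<le> ennreal (e * (N * x))" .
        show "AE y in lborel. 0 < y \<longrightarrow> y < x \<longrightarrow> H y \<le> ennreal (M * y powr 0)"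
          using le_M by (auto elim!: eventually_mono)
      qed (use x exponents M_pos in auto)
      also have "\<dots> = ennreal (L * (e * (N * x)) + 1 / L * (M * Beta (1 - 2 * \<beta>) (1 - 2 * \<beta>) * x powr (1 - 2 * \<beta> - 2 * \<beta>)))"
        using L e N x B M_pos by (subst ennreal_plus) (auto simp: ennreal_mult'[symmetric])
      finally have "H x \<le> ennreal (C * (M / \<alpha>) * x powr (2 * \<beta> - 1)) * \<dots>"
        using elim x(1) by (meson mult_left_mono order_trans zero_le)
      also have "\<dots> = ennreal (C * (M / \<alpha>) * x powr (2 * \<beta> - 1) *
          (L * (e * (N * x)) + 1 / L * (M * Beta (1 - 2 * \<beta>) (1 - 2 * \<beta>) * x powr (1 - 2 * \<beta> - 2 * \<beta>))))"
        using constants M_pos exponents by (simp add: ennreal_mult'[symmetric])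
      also have "C * (M / \<alpha>) * x powr (2 * \<beta> - 1) *
          (L * (e * (N * x)) + 1 / L * (M * Beta (1 - 2 * \<beta>) (1 - 2 * \<beta>) * x powr (1 - 2 * \<beta> - 2 * \<beta>)))
        = C * (M / \<alpha>) * (l * N * e + M * Beta (1 - 2 * \<beta>) (1 - 2 * \<beta>) / l)"
      proof -
        have "L * (e * (N * x)) = l * N * e * (x powr (-(2 * \<beta>)) * x powr 1)"
          using x by (simp add: L_def)
        also have "x powr (-(2 * \<beta>)) * x powr 1 = x powr (1 - 2 * \<beta>)"
          by (subst powr_add[symmetric]) simp
        finally have 1: "L * (e * (N * x)) = l * N * e * x powr (1 - 2 * \<beta>)" .
        have "1 / L * (M * Beta (1 - 2 * \<beta>) (1 - 2 * \<beta>) * x powr (1 - 2 * \<beta> - 2 * \<beta>))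
          = M * Beta (1 - 2 * \<beta>) (1 - 2 * \<beta>) / l * (x powr (2 * \<beta>) * x powr (1 - 2 * \<beta> - 2 * \<beta>))"
          using x by (simp add: L_def powr_minus field_simps)
        also have "x powr (2 * \<beta>) * x powr (1 - 2 * \<beta> - 2 * \<beta>) = x powr (1 - 2 * \<beta>)"
          by (simp add: powr_add[symmetric])
        finally have 2: "1 / L * (M * Beta (1 - 2 * \<beta>) (1 - 2 * \<beta>) * x powr (1 - 2 * \<beta> - 2 * \<beta>))
          = M * Beta (1 - 2 * \<beta>) (1 - 2 * \<beta>) / l * x powr (1 - 2 * \<beta>)" .
        have "C * (M / \<alpha>) * x powr (2 * \<beta> - 1) * (l * N * e * x powr (1 - 2 * \<beta>)
            + M * Beta (1 - 2 * \<beta>) (1 - 2 * \<beta>) / l * x powr (1 - 2 * \<beta>))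
          = C * (M / \<alpha>) * (l * N * e + M * Beta (1 - 2 * \<beta>) (1 - 2 * \<beta>) / l)
            * (x powr (2 * \<beta> - 1) * x powr (1 - 2 * \<beta>))"
          by (simp add: algebra_simps)
        also have "x powr (2 * \<beta> - 1) * x powr (1 - 2 * \<beta>) = 1"
          using x by (simp add: powr_add[symmetric])
        finally show ?thesis unfolding 1 2 by simp
      qed
      finally show "H x \<le> ennreal (C * (M / \<alpha>) * (l * N * e + M * Beta (1 - 2 * \<beta>) (1 - 2 * \<beta>) / l))" .
    qed
  qed
qed

section \<open>The lower bound near zero\<close>

text \<open>The constants are chosen in the order \<open>\<Lambda>\<close>, \<open>\<delta>\<close>, \<open>q\<close>, \<open>N\<close>, \<open>l\<close>, \<open>\<epsilon>\<close>, \<open>m\<close>.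
  If \<open>H < m\<close> occurred on non-null sets arbitrarily close to 0, then
  \<open>H \<le> \<delta>\<close> on an interval of ratio \<open>N\<close> to the left of such a point, hence everywhere to
  the right of it, hence on the whole half-line, which is impossible.\<close>
lemma essential_lower_bound:
  fixes \<alpha> \<beta> c C M :: real
  assumes e: "0 < \<alpha>" "\<alpha> \<le> \<beta>" "\<beta> < 1/2" and pos: "0 < c" "0 < C" "0 < M"
  shows "\<exists>m>0. \<forall>H. bounded_profile \<alpha> \<beta> c C H M \<longrightarrow>
    (\<exists>r>0. AE x in lborel. 0 < x \<longrightarrow> x < r \<longrightarrow> ennreal m \<le> H x)"
proof -
  define b0 where "b0 = Beta (1 - \<beta>) (1 - \<beta>)"
  define b1 where "b1 = Beta (3/4 - \<beta>) (1 - \<beta>)"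
  define b2 where "b2 = Beta (3/4 - \<beta>) (1/2 - \<beta>)"
  define b3 where "b3 = Beta (1 - 2 * \<beta>) (1 - 2 * \<beta>)"
  have b: "0 \<le> b0" "0 \<le> b1" "0 \<le> b2" "0 \<le> b3"
    unfolding b0_def b1_def b2_def b3_def using e by (auto intro!: Beta_nonneg_real)
  have "((\<lambda>\<Lambda>. C * (2 * M / \<alpha> * \<Lambda> powr (-\<alpha>) * b1 + M / \<alpha> * \<Lambda> powr (-(1/2)) * b2)) \<longlongrightarrow>
      C * (2 * M / \<alpha> * 0 * b1 + M / \<alpha> * 0 * b2)) at_top"
    using e by (intro tendsto_intros tendsto_neg_powr filterlim_ident) auto
  then have ev1: "\<forall>\<^sub>F \<Lambda> in at_top. C * (2 * M / \<alpha> * \<Lambda> powr (-\<alpha>) * b1 + M / \<alpha> * \<Lambda> powr (-(1/2)) * b2) < 1/2"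
    by (rule order_tendstoD) simp
  have "((\<lambda>\<Lambda>. C * (M * \<Lambda> powr (-\<alpha>) / \<alpha>) * b0) \<longlongrightarrow> C * (M * 0 / \<alpha>) * b0) at_top"
    using e by (intro tendsto_intros tendsto_neg_powr filterlim_ident) auto
  then have ev2: "\<forall>\<^sub>F \<Lambda> in at_top. C * (M * \<Lambda> powr (-\<alpha>) / \<alpha>) * b0 < 1/2"
    by (rule order_tendstoD) simp
  have "\<forall>\<^sub>F \<Lambda> in at_top. C * (2 * M / \<alpha> * \<Lambda> powr (-\<alpha>) * b1 + M / \<alpha> * \<Lambda> powr (-(1/2)) * b2) < 1/2 \<and>
     C * (M * \<Lambda> powr (-\<alpha>) / \<alpha>) * b0 < 1/2 \<and> (1::real) \<le> \<Lambda>"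
    using ev1 ev2 eventually_ge_at_top[of "1::real"] by eventually_elim auto
  then obtain \<Lambda> where \<Lambda>: "C * (2 * M / \<alpha> * \<Lambda> powr (-\<alpha>) * b1 + M / \<alpha> * \<Lambda> powr (-(1/2)) * b2) < 1/2"
     "C * (M * \<Lambda> powr (-\<alpha>) / \<alpha>) * b0 < 1/2" "1 \<le> \<Lambda>"
    by (auto simp: eventually_at_top_linorder)
  define \<delta> where "\<delta> = M * \<Lambda> powr (-\<alpha>)"
  have \<delta>: "0 < \<delta>" using pos \<Lambda> by (simp add: \<delta>_def)
  define \<kappa> where "\<kappa> = C * (M / \<alpha>)"
  have CM: "0 < \<kappa>" using pos e by (simp add: \<kappa>_def)
  have "0 < \<beta>" "0 < 1 / (2 * \<kappa>)" using e CM by simp_all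
  from Beta_shift_small[OF this(1) e(3) this(2)]
  obtain q where q: "0 < q" "Beta (1 - \<beta> + q) (1 - \<beta>) \<le> 1 / (2 * \<kappa>)"
    by blast
  have q': "\<kappa> * Beta (1 - \<beta> + q) (1 - \<beta>) \<le> 1/2"
    using mult_left_mono[OF q(2), of "\<kappa>"] CM by simp
  define D where "D = 4 * C * M\<^sup>2 / \<alpha> * b1 * (2 * \<Lambda>) powr q"
  have D: "0 \<le> D" unfolding D_def using b pos e by simp
  define t where "t = 2 + D / \<delta>"
  have t: "2 \<le> t" "D / t \<le> \<delta>"
  proof -
    show "2 \<le> t" using D \<delta> by (simp add: t_def)
    moreover have "D \<le> \<delta> * t" using \<delta> by (simp add: t_def algebra_simps)
    ultimately show "D / t \<le> \<delta>" by (simp add: pos_divide_le_eq)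
  qed
  define N where "N = \<Lambda>\<^sup>2 * t ^ 4"
  have N: "\<Lambda> < N"
  proof -
    have "\<Lambda> * 1 < (\<Lambda> * \<Lambda>) * t ^ 4"
      using \<Lambda> t one_less_power[of t 4] by (intro mult_le_less_imp_less) auto
    then show ?thesis by (simp add: N_def power2_eq_square)
  qed
  have gap: "D * (\<Lambda>\<^sup>2 / N) powr (1/4) \<le> \<delta>"
  proof -
    have "\<Lambda>\<^sup>2 / N = 1 / t ^ 4" using \<Lambda> by (simp add: N_def)
    also have "\<dots> = t powr (-4)" using t powr_numeral[of t "num.Bit0 (num.Bit0 num.One)"] by (simp add: powr_minus_divide)
    finally have "(\<Lambda>\<^sup>2 / N) powr (1/4) = t powr (-1)" by (simp add: powr_powr)
    also have "\<dots> = 1 / t" using t by (simp add: powr_minus_divide)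
    finally show ?thesis using t by simp
  qed
  define l where "l = 2 * \<kappa> * (M * b3) / \<delta> + 1"
  have l: "0 < l" "\<kappa> * (M * b3 / l) \<le> \<delta> / 2"
  proof -
    have *: "0 \<le> 2 * \<kappa> * (M * b3) / \<delta>" using CM pos b \<delta> by simp
    then show "0 < l" by (simp add: l_def)
    moreover have "2 * \<kappa> * (M * b3) \<le> \<delta> * l" using \<delta> by (simp add: l_def algebra_simps)
    ultimately show "\<kappa> * (M * b3 / l) \<le> \<delta> / 2" by (simp add: field_simps)
  qed
  define \<epsilon> where "\<epsilon> = \<delta> / (2 * \<kappa> * (l * N))"
  have N0: "0 < N" "1 < N" using N \<Lambda> by auto
  have \<epsilon>: "0 < \<epsilon>" "\<kappa> * (l * N * \<epsilon>) = \<delta> / 2"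
    using CM \<delta> l N0 pos e by (auto simp: \<epsilon>_def)
  obtain m where m: "0 < m" "\<And>H. bounded_profile \<alpha> \<beta> c C H M \<Longrightarrow>
    AE x in lborel. 0 < x \<longrightarrow> H x \<le> ennreal m \<longrightarrow> mass H 0 x \<le> ennreal (\<epsilon> * x)"
    using small_value_small_average[OF pos(1) \<epsilon>(1) pos(3), of \<alpha> \<beta> C] by blast
  have "\<exists>r>0. AE x in lborel. 0 < x \<longrightarrow> x < r \<longrightarrow> ennreal m \<le> H x"
    if bp: "bounded_profile \<alpha> \<beta> c C H M" for H
  proof (rule ccontr)
    assume contra: "\<not> ?thesis"
    interpret bounded_profile \<alpha> \<beta> c C H M by fact
    have beyond: "AE x in lborel. r < x \<longrightarrow> H x \<le> ennreal \<delta>" if r: "0 < r" for r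
    proof -
      have "\<exists>x. 0 < x \<and> x < r \<and> H x < ennreal m \<and> mass H 0 x \<le> ennreal (\<epsilon> * x)"
      proof (rule ccontr)
        assume none: "\<not> ?thesis"
        have "AE x in lborel. 0 < x \<longrightarrow> x < r \<longrightarrow> ennreal m \<le> H x"
          using m(2)[OF bp]
        proof eventually_elim
          case (elim x)
          show ?case
          proof (intro impI, rule ccontr)
            assume x: "0 < x" "x < r" "\<not> ennreal m \<le> H x"
            then have "H x < ennreal m" "mass H 0 x \<le> ennreal (\<epsilon> * x)"
              using elim by (auto simp: not_le)
            then show False using none x by blast
          qed
        qed
        then show False using contra r by blast
      qed
      then obtain x where x: "0 < x" "x < r" "mass H 0 x \<le> ennreal (\<epsilon> * x)" by auto
      define a where "a = x / N"
      have a: "0 < a" "N * a = x" "a < x" using x N0 by (auto simp: a_def field_simps)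
      have "\<kappa> * (l * N * \<epsilon> + M * b3 / l) \<le> \<delta>"
        using \<epsilon>(2) l(2) by (simp only: distrib_left)
      then have near: "AE y in lborel. a < y \<longrightarrow> y < N * a \<longrightarrow> H y \<le> ennreal \<delta>"
        using small_average_small_nearby[OF l(1) N0(1) less_imp_le[OF \<epsilon>(1)] x(3)] a
        unfolding b3_def a_def[symmetric] \<kappa>_def
        by (auto elim!: eventually_mono intro: order_trans ennreal_leI)
      have "AE y in lborel. a < y \<longrightarrow> H y \<le> ennreal \<delta>"
        using small_forever[OF \<Lambda>(3) less_imp_le[OF q(1)] N less_imp_le[OF \<Lambda>(1)[unfolded b1_def b2_def]]
            q'[unfolded \<kappa>_def] gap[unfolded D_def b1_def \<delta>_def] a(1) near[unfolded \<delta>_def]]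
        by (simp add: \<delta>_def)
      then show ?thesis using a x by (auto elim!: eventually_mono)
    qed
    then have "AE x in lborel. \<forall>n::nat. 1 / real (Suc n) < x \<longrightarrow> H x \<le> ennreal \<delta>"
      by (subst AE_all_countable) auto
    then have "AE x in lborel. 0 < x \<longrightarrow> H x \<le> ennreal \<delta>"
    proof eventually_elim
      case (elim x)
      show ?case
      proof
        assume "0 < x"
        then obtain n :: nat where "1 / real (Suc n) < x" by (rule nat_approx_posE)
        then show "H x \<le> ennreal \<delta>" using elim by blast
      qed
    qed
    then show False
      using not_small_everywhere[of \<delta>] \<delta> \<Lambda>(2) by (simp add: \<delta>_def b0_def)
  qed
  with m(1) show ?thesis by blast
qed

section \<open>From the profile equation to the two inequalities\<close>

lemma tail_rate_measurable:
  assumes [measurable]: "F \<in> borel_measurable borel"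
  shows "tail_rate \<alpha> F \<in> borel_measurable borel"
proof -
  have "(\<integral>\<^sup>+z\<in>{w<..}. ennreal (z powr (-1 - \<alpha>)) * F z \<partial>lborel)
     = (\<integral>\<^sup>+z. (if w < z then ennreal (z powr (-1 - \<alpha>)) * F z else 0) \<partial>lborel)" for w
    by (intro nn_integral_cong) (auto simp: indicator_def)
  then show ?thesis unfolding tail_rate_def by simp
qed

text \<open>The right-hand side of the profile equation without the factor \<open>h_const\<close>, for a profile with values
  in \<open>[0, \<infinity>]\<close>. The reciprocal of \<open>h_const\<close> is its value at 1 on the constant profile 1.\<close>
definition profile_operator :: "real \<Rightarrow> (real \<Rightarrow> real \<Rightarrow> real) \<Rightarrow> (real \<Rightarrow> ennreal) \<Rightarrow> real \<Rightarrow> ennreal" where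
  "profile_operator lam K F x = ennreal (x powr (2 * lam - 1)) *
     (\<integral>\<^sup>+y\<in>{0<..<x}. ennreal (y powr (-(2 * lam))) * F y *
        (\<integral>\<^sup>+z\<in>{x - y<..}. ennreal (K y z * z powr (-(1 + 2 * lam))) * F z \<partial>lborel) \<partial>lborel)"

text \<open>No measurability of \<open>K\<close> is involved: the integrands are compared with multiples of measurable
  functions before any constant is taken out of an integral.\<close>
lemma profile_operator_le:
  assumes K: "admissible_kernel lam \<alpha> \<beta> k0 K0 K" and K0: "0 < K0" and x: "0 < x"
    and F [measurable]: "F \<in> borel_measurable borel"
  shows "profile_operator lam K F x \<le> ennreal (2 * K0 * x powr (2 * \<beta> - 1)) *
    (\<integral>\<^sup>+y\<in>{0<..<x}. ennreal (y powr (-\<beta>) * (x - y) powr (-\<beta>)) * (tail_rate \<alpha> F (x - y) * F y) \<partial>lborel)"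
proof -
  note [measurable] = tail_rate_measurable[OF F]
  have exps: "0 < \<alpha>" "\<alpha> \<le> \<beta>" "\<alpha> + \<beta> = 2 * lam" and growth:
    "\<And>y z. 0 < y \<Longrightarrow> 0 < z \<Longrightarrow> K y z \<le> K0 * (y powr \<alpha> * z powr \<beta> + y powr \<beta> * z powr \<alpha>)"
    using K unfolding admissible_kernel_def by auto
  have pointwise: "K y z * z powr (-(1 + 2 * lam))
      \<le> y powr (2 * lam) * (2 * K0 * x powr (\<beta> - \<alpha>) * (y powr (-\<beta>) * w powr (-\<beta>)) * w powr \<alpha>) * z powr (-1 - \<alpha>)"
    if w: "0 < w" "w \<le> x" and y: "0 < y" "y \<le> x" and z: "w < z" for y w z
  proof -
    have "K y z * z powr (-(1 + 2 * lam))
      \<le> K0 * (y powr \<alpha> * z powr \<beta> + y powr \<beta> * z powr \<alpha>) * z powr (-(1 + 2 * lam))"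
      using growth[of y z] w y z by (intro mult_right_mono) auto
    also have "\<dots> = K0 * (y powr \<alpha> * (z powr \<beta> * z powr (-(1 + 2 * lam))) + y powr \<beta> * (z powr \<alpha> * z powr (-(1 + 2 * lam))))"
      by (simp add: algebra_simps)
    also have "z powr \<beta> * z powr (-(1 + 2 * lam)) = z powr (-1 - \<alpha>)"
      by (simp only: powr_add[symmetric], rule arg_cong2[where f = "(powr)", OF refl]) (use exps(3) in linarith)
    also have "z powr \<alpha> * z powr (-(1 + 2 * lam)) = z powr (\<alpha> - \<beta>) * z powr (-1 - \<alpha>)"
      by (simp only: powr_add[symmetric], rule arg_cong2[where f = "(powr)", OF refl]) (use exps(3) in linarith)
    also have "y powr \<alpha> = y powr (2 * lam) * y powr (-\<beta>)"
      by (simp only: powr_add[symmetric], rule arg_cong2[where f = "(powr)", OF refl]) (use exps(3) in linarith)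
    also have "y powr \<beta> = y powr (2 * lam) * (y powr (\<beta> - \<alpha>) * y powr (-\<beta>))"
      by (simp only: powr_add[symmetric], rule arg_cong2[where f = "(powr)", OF refl]) (use exps(3) in linarith)
    also have "K0 * (y powr (2 * lam) * y powr (-\<beta>) * z powr (-1 - \<alpha>)
        + y powr (2 * lam) * (y powr (\<beta> - \<alpha>) * y powr (-\<beta>)) * (z powr (\<alpha> - \<beta>) * z powr (-1 - \<alpha>)))
      = K0 * y powr (2 * lam) * y powr (-\<beta>) * z powr (-1 - \<alpha>) * (1 + y powr (\<beta> - \<alpha>) * z powr (\<alpha> - \<beta>))"
      by (simp add: algebra_simps)
    also have "\<dots> \<le> K0 * y powr (2 * lam) * y powr (-\<beta>) * z powr (-1 - \<alpha>)
        * (x powr (\<beta> - \<alpha>) * w powr (\<alpha> - \<beta>) + x powr (\<beta> - \<alpha>) * w powr (\<alpha> - \<beta>))"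
    proof (intro mult_left_mono add_mono mult_mono)
      have "1 = w powr (\<beta> - \<alpha>) * w powr (\<alpha> - \<beta>)" using w by (simp add: powr_add[symmetric])
      also have "\<dots> \<le> x powr (\<beta> - \<alpha>) * w powr (\<alpha> - \<beta>)"
        using w exps by (intro mult_right_mono powr_mono2) auto
      finally show "1 \<le> x powr (\<beta> - \<alpha>) * w powr (\<alpha> - \<beta>)" .
      show "y powr (\<beta> - \<alpha>) \<le> x powr (\<beta> - \<alpha>)" using y exps by (intro powr_mono2) auto
      show "z powr (\<alpha> - \<beta>) \<le> w powr (\<alpha> - \<beta>)" using z w exps by (intro powr_mono2') auto
    qed (use K0 in auto)
    also have "w powr (\<alpha> - \<beta>) = w powr (-\<beta>) * w powr \<alpha>"
      by (simp add: powr_add[symmetric])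
    finally show ?thesis by (simp add: mult_ac)
  qed
  let ?J = "\<integral>\<^sup>+y\<in>{0<..<x}. ennreal (y powr (-\<beta>) * (x - y) powr (-\<beta>)) * (tail_rate \<alpha> F (x - y) * F y) \<partial>lborel"
  have "(\<integral>\<^sup>+y\<in>{0<..<x}. ennreal (y powr (-(2 * lam))) * F y *
        (\<integral>\<^sup>+z\<in>{x - y<..}. ennreal (K y z * z powr (-(1 + 2 * lam))) * F z \<partial>lborel) \<partial>lborel)
     \<le> (\<integral>\<^sup>+y. ennreal (2 * K0 * x powr (\<beta> - \<alpha>)) *
        (ennreal (y powr (-\<beta>) * (x - y) powr (-\<beta>)) * (tail_rate \<alpha> F (x - y) * F y) * indicator {0<..<x} y) \<partial>lborel)"
  proof (rule nn_integral_mono)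
    fix y
    show "ennreal (y powr (-(2 * lam))) * F y *
        (\<integral>\<^sup>+z\<in>{x - y<..}. ennreal (K y z * z powr (-(1 + 2 * lam))) * F z \<partial>lborel) * indicator {0<..<x} y
      \<le> ennreal (2 * K0 * x powr (\<beta> - \<alpha>)) *
        (ennreal (y powr (-\<beta>) * (x - y) powr (-\<beta>)) * (tail_rate \<alpha> F (x - y) * F y) * indicator {0<..<x} y)"
    proof (cases "y \<in> {0<..<x}")
      case True
      define w where "w = x - y"
      have y: "0 < y" "y \<le> x" "0 < w" "w \<le> x" using True by (auto simp: w_def)
      define A where "A = 2 * K0 * x powr (\<beta> - \<alpha>) * (y powr (-\<beta>) * w powr (-\<beta>))"
      have A: "0 \<le> A" using K0 by (simp add: A_def)
      have "(\<integral>\<^sup>+z\<in>{w<..}. ennreal (K y z * z powr (-(1 + 2 * lam))) * F z \<partial>lborel)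
        \<le> (\<integral>\<^sup>+z. ennreal (y powr (2 * lam) * (A * w powr \<alpha>)) * (ennreal (z powr (-1 - \<alpha>)) * F z * indicator {w<..} z) \<partial>lborel)"
      proof (rule nn_integral_mono)
        fix z
        show "ennreal (K y z * z powr (-(1 + 2 * lam))) * F z * indicator {w<..} z
          \<le> ennreal (y powr (2 * lam) * (A * w powr \<alpha>)) * (ennreal (z powr (-1 - \<alpha>)) * F z * indicator {w<..} z)"
        proof (cases "w < z")
          case True
          have "ennreal (K y z * z powr (-(1 + 2 * lam))) * F z
            \<le> ennreal (y powr (2 * lam) * (A * w powr \<alpha>) * z powr (-1 - \<alpha>)) * F z"
            using pointwise[OF y(3,4,1,2) True] unfolding A_def by (intro mult_right_mono ennreal_leI) auto
          then show ?thesis using True A by (simp add: ennreal_mult' mult_ac)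
        qed auto
      qed
      also have "\<dots> = ennreal (y powr (2 * lam) * (A * w powr \<alpha>)) * (\<integral>\<^sup>+z\<in>{w<..}. ennreal (z powr (-1 - \<alpha>)) * F z \<partial>lborel)"
        by (rule nn_integral_cmult) measurable
      also have "\<dots> = ennreal (y powr (2 * lam) * A) * tail_rate \<alpha> F w"
        using A by (simp add: tail_rate_def ennreal_mult' mult_ac)
      finally have "ennreal (y powr (-(2 * lam))) * F y *
          (\<integral>\<^sup>+z\<in>{w<..}. ennreal (K y z * z powr (-(1 + 2 * lam))) * F z \<partial>lborel)
        \<le> ennreal (y powr (-(2 * lam))) * F y * (ennreal (y powr (2 * lam) * A) * tail_rate \<alpha> F w)"
        by (intro mult_left_mono) auto
      also have "\<dots> = (ennreal (y powr (-(2 * lam))) * ennreal (y powr (2 * lam) * A)) * (tail_rate \<alpha> F w * F y)"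
        by (simp only: mult_ac)
      also have "ennreal (y powr (-(2 * lam))) * ennreal (y powr (2 * lam) * A) = ennreal A"
        using y A by (simp add: ennreal_mult'[symmetric] powr_minus)
      also have "ennreal A = ennreal (2 * K0 * x powr (\<beta> - \<alpha>)) * ennreal (y powr (-\<beta>) * w powr (-\<beta>))"
        unfolding A_def using K0 by (intro ennreal_mult') auto
      finally show ?thesis using True by (simp add: w_def mult_ac)
    qed auto
  qed
  also have "\<dots> = ennreal (2 * K0 * x powr (\<beta> - \<alpha>)) * ?J"
    by (rule nn_integral_cmult) measurable
  finally have "profile_operator lam K F x
      \<le> ennreal (x powr (2 * lam - 1)) * (ennreal (2 * K0 * x powr (\<beta> - \<alpha>)) * ?J)"
    unfolding profile_operator_def by (intro mult_left_mono) auto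
  also have "\<dots> = ennreal (2 * K0 * (x powr (2 * lam - 1) * x powr (\<beta> - \<alpha>))) * ?J"
    using K0 by (simp add: ennreal_mult' mult_ac)
  also have "x powr (2 * lam - 1) * x powr (\<beta> - \<alpha>) = x powr (2 * \<beta> - 1)"
    by (simp only: powr_add[symmetric], rule arg_cong2[where f = "(powr)", OF refl]) (use exps(3) in linarith)
  finally show ?thesis .
qed

lemma profile_operator_ge:
  assumes K: "admissible_kernel lam \<alpha> \<beta> k0 K0 K" and k0: "0 < k0"
    and R: "0 < x" "R / 2 < x" "x \<le> R"
    and F [measurable]: "F \<in> borel_measurable borel"
  shows "ennreal (k0 / (2 * R\<^sup>2)) * (mass F (R/2) x * mass F (R/2) (2 * R)) \<le> profile_operator lam K F x"
proof -
  have R0: "0 < R" using R by simp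
  have lam: "0 < lam" "2 * lam < 1" and hom: "\<And>a y z. 0 < a \<Longrightarrow> 0 < y \<Longrightarrow> 0 < z \<Longrightarrow> K (a * y) (a * z) = a powr (2 * lam) * K y z"
    and diag: "\<And>y z. y \<in> {1/4..1} \<Longrightarrow> z \<in> {1/4..1} \<Longrightarrow> k0 \<le> K y z"
    using K unfolding admissible_kernel_def by auto
  have kernel: "k0 / (2 * R) \<le> K y z * z powr (-(1 + 2 * lam))"
    if y: "R / 2 < y" "y < R" and z: "R / 2 < z" "z < 2 * R" for y z
  proof -
    have "k0 / (2 * R) = (2 * R) powr (2 * lam) * k0 * (2 * R) powr (-(1 + 2 * lam))"
    proof -
      have "(2 * R) powr (2 * lam) * (2 * R) powr (-(1 + 2 * lam)) = (2 * R) powr (-1)"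
        by (simp add: powr_add[symmetric])
      also have "\<dots> = 1 / (2 * R)" using R0 by (simp add: powr_minus_divide)
      finally show ?thesis by (simp add: mult_ac)
    qed
    also have "\<dots> \<le> (2 * R) powr (2 * lam) * K (y / (2 * R)) (z / (2 * R)) * z powr (-(1 + 2 * lam))"
      using y z R0 lam k0 diag[of "y / (2 * R)" "z / (2 * R)"]
      by (intro mult_mono mult_left_mono powr_mono2') (auto simp: field_simps)
    also have "(2 * R) powr (2 * lam) * K (y / (2 * R)) (z / (2 * R)) = K y z"
      using hom[of "2 * R" "y / (2 * R)" "z / (2 * R)"] y z R0 by simp
    finally show ?thesis .
  qed
  let ?P = "mass F (R/2) (2 * R)"
  \<comment> \<open>From \<open>y > R/2\<close> and \<open>x \<le> R\<close> one has \<open>x - y < R/2\<close>, so every \<open>z\<close> in \<open>(R/2, 2 * R)\<close>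
    takes part.\<close>
  have inner: "ennreal (k0 / (2 * R)) * ?P
      \<le> (\<integral>\<^sup>+z\<in>{x - y<..}. ennreal (K y z * z powr (-(1 + 2 * lam))) * F z \<partial>lborel)"
    if y: "R / 2 < y" "y < x" for y
  proof -
    have "ennreal (k0 / (2 * R)) * ?P = (\<integral>\<^sup>+z. ennreal (k0 / (2 * R)) * (F z * indicator {R/2<..<2 * R} z) \<partial>lborel)"
      unfolding mass_def by (rule nn_integral_cmult[symmetric]) measurable
    also have "\<dots> \<le> (\<integral>\<^sup>+z\<in>{x - y<..}. ennreal (K y z * z powr (-(1 + 2 * lam))) * F z \<partial>lborel)"
      using y R kernel
      by (intro nn_integral_mono) (auto simp: indicator_def intro!: mult_right_mono ennreal_leI)
    finally show ?thesis .
  qed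
  have "ennreal (R powr (-(2 * lam))) * (ennreal (k0 / (2 * R)) * ?P) * mass F (R/2) x
      = (\<integral>\<^sup>+y. (ennreal (R powr (-(2 * lam))) * (ennreal (k0 / (2 * R)) * ?P)) * (F y * indicator {R/2<..<x} y) \<partial>lborel)"
    unfolding mass_def[of F "R/2" x] by (rule nn_integral_cmult[symmetric]) measurable
  also have "\<dots> \<le> (\<integral>\<^sup>+y\<in>{0<..<x}. ennreal (y powr (-(2 * lam))) * F y *
        (\<integral>\<^sup>+z\<in>{x - y<..}. ennreal (K y z * z powr (-(1 + 2 * lam))) * F z \<partial>lborel) \<partial>lborel)"
  proof (rule nn_integral_mono)
    fix y
    show "(ennreal (R powr (-(2 * lam))) * (ennreal (k0 / (2 * R)) * ?P)) * (F y * indicator {R/2<..<x} y)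
      \<le> ennreal (y powr (-(2 * lam))) * F y *
        (\<integral>\<^sup>+z\<in>{x - y<..}. ennreal (K y z * z powr (-(1 + 2 * lam))) * F z \<partial>lborel) * indicator {0<..<x} y"
    proof (cases "y \<in> {R/2<..<x}")
      case True
      then have "(ennreal (R powr (-(2 * lam))) * F y) * (ennreal (k0 / (2 * R)) * ?P)
        \<le> (ennreal (y powr (-(2 * lam))) * F y) *
        (\<integral>\<^sup>+z\<in>{x - y<..}. ennreal (K y z * z powr (-(1 + 2 * lam))) * F z \<partial>lborel)"
        using R R0 lam by (intro mult_mono inner mult_right_mono ennreal_leI powr_mono2') auto
      then show ?thesis using True R0 by (simp add: mult_ac)
    qed auto
  qed
  finally have "ennreal (x powr (2 * lam - 1)) * (ennreal (R powr (-(2 * lam))) * (ennreal (k0 / (2 * R)) * ?P) * mass F (R/2) x)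
      \<le> profile_operator lam K F x"
    unfolding profile_operator_def by (intro mult_left_mono) auto
  moreover have "ennreal (R powr (2 * lam - 1)) \<le> ennreal (x powr (2 * lam - 1))"
    using R lam by (intro ennreal_leI powr_mono2') auto
  ultimately have "ennreal (R powr (2 * lam - 1)) * (ennreal (R powr (-(2 * lam))) * (ennreal (k0 / (2 * R)) * ?P) * mass F (R/2) x)
      \<le> profile_operator lam K F x"
    by (meson mult_right_mono order_trans zero_le)
  moreover have "ennreal (R powr (2 * lam - 1)) * (ennreal (R powr (-(2 * lam))) * (ennreal (k0 / (2 * R)) * ?P) * mass F (R/2) x)
     = ennreal (k0 / (2 * R\<^sup>2)) * (mass F (R/2) x * ?P)"
  proof -
    have "R powr (2 * lam - 1) * R powr (-(2 * lam)) = R powr (-1)"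
      by (simp add: powr_add[symmetric])
    also have "\<dots> = 1 / R" using R0 by (simp add: powr_minus_divide)
    finally have "R powr (2 * lam - 1) * (R powr (-(2 * lam)) * (k0 / (2 * R))) = k0 / (2 * R\<^sup>2)"
      by (simp add: mult.assoc[symmetric] power2_eq_square)
    then have e: "ennreal (R powr (2 * lam - 1)) * (ennreal (R powr (-(2 * lam))) * ennreal (k0 / (2 * R))) = ennreal (k0 / (2 * R\<^sup>2))"
      by (simp add: ennreal_mult'[symmetric])
    show ?thesis unfolding e[symmetric] by (simp only: mult_ac)
  qed
  ultimately show ?thesis by simp
qed

lemma h_const_bounds:
  assumes K: "admissible_kernel lam \<alpha> \<beta> k0 K0 K" and k0: "0 < k0" and K0: "0 < K0"
  shows "\<alpha> / (2 * K0 * Beta (1 - \<beta>) (1 - \<beta>)) \<le> h_const lam K" "h_const lam K \<le> 8 / (3 * k0)"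
proof -
  have exps: "0 < \<alpha>" "\<beta> < 1/2" "\<alpha> \<le> \<beta>" using K unfolding admissible_kernel_def by auto
  have B: "0 < Beta (1 - \<beta>) (1 - \<beta>)" using exps by (simp add: Beta_def Gamma_real_pos)
  define I where "I = (\<integral>\<^sup>+ s\<in>{0<..<1}. ennreal (s powr (- (2 * lam))) *
        (\<integral>\<^sup>+ t\<in>{1 - s<..}. ennreal (K s t * t powr (- (1 + 2 * lam))) \<partial>lebesgue) \<partial>lebesgue)"
  have I: "I = profile_operator lam K (\<lambda>_. 1) 1"
    by (simp add: I_def profile_operator_def nn_integral_completion)
  have rate: "tail_rate \<alpha> (\<lambda>_. 1) w = ennreal (1 / \<alpha>)" if "0 < w" for w
    using set_nn_integral_powr_tail[of \<alpha> w] that exps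
    by (simp add: tail_rate_def ennreal_mult'[symmetric] powr_minus)
  have "I \<le> ennreal (2 * K0 * 1 powr (2 * \<beta> - 1)) *
    (\<integral>\<^sup>+y\<in>{0<..<1}. ennreal (y powr (-\<beta>) * (1 - y) powr (-\<beta>)) * (tail_rate \<alpha> (\<lambda>_. 1) (1 - y) * 1) \<partial>lborel)"
    unfolding I using profile_operator_le[OF K K0, of 1 "\<lambda>_. 1"] by simp
  also have "(\<integral>\<^sup>+y\<in>{0<..<1}. ennreal (y powr (-\<beta>) * (1 - y) powr (-\<beta>)) * (tail_rate \<alpha> (\<lambda>_. 1) (1 - y) * 1) \<partial>lborel)
    = (\<integral>\<^sup>+y. ennreal (1 / \<alpha>) * (ennreal ((y - 0) powr (-\<beta>) * (1 - y) powr (-\<beta>)) * indicator {0<..<1} y) \<partial>lborel)"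
    by (intro nn_integral_cong) (auto simp: indicator_def rate mult_ac)
  also have "\<dots> = ennreal (1 / \<alpha>) * ennreal (Beta (1 - \<beta>) (1 - \<beta>))"
    using set_nn_integral_powr_conv[of \<beta> \<beta> 0 1] exps by (subst nn_integral_cmult) auto
  also have "ennreal (2 * K0 * 1 powr (2 * \<beta> - 1)) * \<dots> = ennreal (2 * K0 * Beta (1 - \<beta>) (1 - \<beta>) / \<alpha>)"
    using K0 exps B by (simp add: ennreal_mult'[symmetric])
  finally have up: "I \<le> ennreal (2 * K0 * Beta (1 - \<beta>) (1 - \<beta>) / \<alpha>)" .
  have "ennreal (k0 / (2 * 1\<^sup>2)) * (mass (\<lambda>_. 1) (1/2) 1 * mass (\<lambda>_. 1) (1/2) (2 * 1)) \<le> I"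
    unfolding I by (rule profile_operator_ge[OF K k0]) auto
  moreover have "mass (\<lambda>_. 1) (1/2) 1 = ennreal (1 - 1/2)" "mass (\<lambda>_. 1) (1/2) (2 * 1) = ennreal (2 * 1 - 1/2)"
    by (simp_all add: mass_def)
  moreover have "ennreal (r * (s * t)) = ennreal r * (ennreal s * ennreal t)" if "0 \<le> r" "0 \<le> s" for r s t
    using that by (simp add: ennreal_mult')
  from this[of "k0 / (2 * 1\<^sup>2)" "1 - 1/2" "2 * 1 - 1/2"]
  have "ennreal (k0 / (2 * 1\<^sup>2) * ((1 - 1/2) * (2 * 1 - 1/2)))
      = ennreal (k0 / (2 * 1\<^sup>2)) * (ennreal (1 - 1/2) * ennreal (2 * 1 - 1/2))"
    using k0 by simp
  ultimately have "ennreal (k0 / (2 * 1\<^sup>2) * ((1 - 1/2) * (2 * 1 - 1/2))) \<le> I"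
    by (simp only:)
  then have low: "ennreal (3 * k0 / 8) \<le> I" by (simp add: mult.commute)
  obtain i where i: "I = ennreal i" "0 \<le> i"
    using up by (cases I) (auto simp: top_unique)
  have "3 * k0 / 8 \<le> i" "i \<le> 2 * K0 * Beta (1 - \<beta>) (1 - \<beta>) / \<alpha>"
    using up low i K0 B exps by (auto simp: ennreal_le_iff)
  moreover have "h_const lam K = inverse i"
    unfolding h_const_def I_def[symmetric] using i by simp
  ultimately show "\<alpha> / (2 * K0 * Beta (1 - \<beta>) (1 - \<beta>)) \<le> h_const lam K" "h_const lam K \<le> 8 / (3 * k0)"
    using k0 K0 B exps le_imp_inverse_le[of "3 * k0 / 8" i]
      le_imp_inverse_le[of i "2 * K0 * Beta (1 - \<beta>) (1 - \<beta>) / \<alpha>"] by auto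
qed

text \<open>Lebesgue measurable profiles are replaced by Borel measurable ones, so that Tonelli's theorem for the
  Borel product is applicable.\<close>
lemma borel_representative:
  assumes h: "h \<in> borel_measurable (lebesgue_on {0<..})"
    and eq: "AE x\<in>{0<..} in lebesgue. profile_equation lam K h x"
    and pos: "\<forall>x>0. 0 < h x" and hc: "0 \<le> h_const lam K"
  obtains H where "H \<in> borel_measurable borel" "AE x in lborel. 0 < x \<longrightarrow> H x = ennreal (h x)"
    "AE x in lborel. 0 < x \<longrightarrow> H x = ennreal (h_const lam K) * profile_operator lam K H x"
proof -
  have "(\<lambda>x. ennreal (h x)) \<in> borel_measurable (lebesgue_on {0<..})"
    using h by measurable
  then have "(\<lambda>x. ennreal (h x) * indicator {0<..} x) \<in> borel_measurable lebesgue"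
    by (subst (asm) borel_measurable_restrict_space_iff_ennreal) auto
  from completion_ex_borel_measurable[OF this]
  obtain H where H: "H \<in> borel_measurable lborel" "AE x in lborel. ennreal (h x) * indicator {0<..} x = H x"
    by blast
  have Hh: "AE x in lborel. 0 < x \<longrightarrow> H x = ennreal (h x)"
    using H(2) by eventually_elim auto
  have split: "ennreal (k * h z) = ennreal k * ennreal (h z)" if "0 < z" for k z
    using pos that by (intro ennreal_mult'') (auto intro: less_imp_le)
  have "(\<integral>\<^sup>+ z\<in>{x - y<..}. ennreal (K y z * z powr (- (1 + 2 * lam)) * h z) \<partial>lebesgue)
     = (\<integral>\<^sup>+ z\<in>{x - y<..}. ennreal (K y z * z powr (- (1 + 2 * lam))) * H z \<partial>lborel)"
    if "0 < y" "y < x" for x y :: real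
    unfolding nn_integral_completion
    using Hh that
    by (intro nn_integral_cong_AE) (auto elim!: eventually_mono simp: indicator_def split)
  then have inner: "(\<integral>\<^sup>+ y\<in>{0<..<x}. ennreal (y powr (- (2 * lam)) * h y) *
          (\<integral>\<^sup>+ z\<in>{x - y<..}. ennreal (K y z * z powr (- (1 + 2 * lam)) * h z) \<partial>lebesgue) \<partial>lebesgue)
     = (\<integral>\<^sup>+y\<in>{0<..<x}. ennreal (y powr (-(2 * lam))) * H y *
        (\<integral>\<^sup>+z\<in>{x - y<..}. ennreal (K y z * z powr (-(1 + 2 * lam))) * H z \<partial>lborel) \<partial>lborel)" for x
    unfolding nn_integral_completion
    using Hh
    by (intro nn_integral_cong_AE) (auto elim!: eventually_mono simp: indicator_def split)
  have "AE x in lborel. 0 < x \<longrightarrow> H x = ennreal (h_const lam K) * profile_operator lam K H x"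
    using eq[unfolded AE_completion_iff] Hh
  proof eventually_elim
    case (elim x)
    show ?case
    proof
      assume "0 < x"
      then have "H x = ennreal (h_const lam K * x powr (2 * lam - 1)) *
          (\<integral>\<^sup>+y\<in>{0<..<x}. ennreal (y powr (-(2 * lam))) * H y *
            (\<integral>\<^sup>+z\<in>{x - y<..}. ennreal (K y z * z powr (-(1 + 2 * lam))) * H z \<partial>lborel) \<partial>lborel)"
        using elim unfolding profile_equation_def inner by simp
      then show "H x = ennreal (h_const lam K) * profile_operator lam K H x"
        unfolding profile_operator_def ennreal_mult'[OF hc] by (simp only: mult.assoc)
    qed
  qed
  with H Hh show ?thesis using that by simp
qed

lemma profile_bounds_of_profile:
  assumes K: "admissible_kernel lam \<alpha> \<beta> k0 K0 K" and k0: "0 < k0" and K0: "0 < K0"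
    and pos: "\<forall>x>0. 0 < h x"
    and H: "H \<in> borel_measurable borel" "AE x in lborel. 0 < x \<longrightarrow> H x = ennreal (h x)"
    "AE x in lborel. 0 < x \<longrightarrow> H x = ennreal (h_const lam K) * profile_operator lam K H x"
  shows "profile_bounds \<alpha> \<beta> (\<alpha> / (2 * K0 * Beta (1 - \<beta>) (1 - \<beta>)) * (k0 / 2)) (8 / (3 * k0) * (2 * K0)) H"
proof
  have exps: "0 < \<alpha>" "\<beta> < 1/2" "\<alpha> \<le> \<beta>" using K unfolding admissible_kernel_def by auto
  have B: "0 < Beta (1 - \<beta>) (1 - \<beta>)" using exps by (simp add: Beta_def Gamma_real_pos)
  let ?u = "\<alpha> / (2 * K0 * Beta (1 - \<beta>) (1 - \<beta>))"
  have u: "0 < ?u" using exps K0 B by simp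
  show "0 < \<alpha>" "\<alpha> \<le> \<beta>" "\<beta> < 1/2" by fact+
  show "0 < ?u * (k0 / 2)" using u k0 by (intro mult_pos_pos) auto
  show "0 < 8 / (3 * k0) * (2 * K0)" using k0 K0 by simp
  show "H \<in> borel_measurable borel" by fact
  show "AE x in lborel. 0 < x \<longrightarrow> 0 < H x" using H(2) by eventually_elim (use pos in auto)
  show "AE x in lborel. 0 < x \<longrightarrow> H x < \<infinity>" using H(2) by eventually_elim auto
  show "AE x in lborel. \<forall>R. 0 < x \<longrightarrow> R / 2 < x \<longrightarrow> x < R \<longrightarrow>
      ennreal (?u * (k0 / 2) / R\<^sup>2) * (mass H (R/2) x * mass H (R/2) (2 * R)) \<le> H x"
    using H(3)
  proof eventually_elim
    case (elim x)
    show ?case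
    proof (intro allI impI)
      fix R :: real assume x: "0 < x" "R / 2 < x" "x < R"
      have "ennreal (?u * (k0 / 2) / R\<^sup>2) * (mass H (R/2) x * mass H (R/2) (2 * R))
        = ennreal ?u * (ennreal (k0 / (2 * R\<^sup>2)) * (mass H (R/2) x * mass H (R/2) (2 * R)))"
      proof -
        have "?u * (k0 / 2) / R\<^sup>2 = ?u * (k0 / (2 * R\<^sup>2))" by simp
        then have "ennreal (?u * (k0 / 2) / R\<^sup>2) = ennreal ?u * ennreal (k0 / (2 * R\<^sup>2))"
          using u by (metis ennreal_mult' less_imp_le)
        then show ?thesis by (simp only: mult.assoc)
      qed
      also have "\<dots> \<le> ennreal (h_const lam K) * profile_operator lam K H x"
        using x h_const_bounds[OF K k0 K0] H(1)
        by (intro mult_mono ennreal_leI profile_operator_ge[OF K k0]) auto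
      also have "\<dots> = H x" using elim x by simp
      finally show "ennreal (?u * (k0 / 2) / R\<^sup>2) * (mass H (R/2) x * mass H (R/2) (2 * R)) \<le> H x" .
    qed
  qed
  show "AE x in lborel. 0 < x \<longrightarrow> H x \<le> ennreal (8 / (3 * k0) * (2 * K0) * x powr (2 * \<beta> - 1)) *
      (\<integral>\<^sup>+y\<in>{0<..<x}. ennreal (y powr (-\<beta>) * (x - y) powr (-\<beta>)) * (tail_rate \<alpha> H (x - y) * H y) \<partial>lborel)"
    using H(3)
  proof eventually_elim
    case (elim x)
    show ?case
    proof
      assume x: "0 < x"
      let ?J = "\<integral>\<^sup>+y\<in>{0<..<x}. ennreal (y powr (-\<beta>) * (x - y) powr (-\<beta>)) * (tail_rate \<alpha> H (x - y) * H y) \<partial>lborel"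
      have "H x = ennreal (h_const lam K) * profile_operator lam K H x" using elim x by simp
      also have "\<dots> \<le> ennreal (8 / (3 * k0)) * (ennreal (2 * K0 * x powr (2 * \<beta> - 1)) * ?J)"
        using x h_const_bounds[OF K k0 K0] H(1)
        by (intro mult_mono ennreal_leI profile_operator_le[OF K K0]) auto
      also have "\<dots> = (ennreal (8 / (3 * k0)) * ennreal (2 * K0 * x powr (2 * \<beta> - 1))) * ?J"
        by (simp only: mult.assoc)
      also have "ennreal (8 / (3 * k0)) * ennreal (2 * K0 * x powr (2 * \<beta> - 1)) = ennreal (8 / (3 * k0) * (2 * K0) * x powr (2 * \<beta> - 1))"
        using k0 by (subst ennreal_mult'[symmetric]) (auto simp: mult.assoc)
      finally show "H x \<le> \<dots> * ?J" .
    qed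
  qed
qed

section \<open>The theorem\<close>

text \<open>The essential infimum over \<open>(0, r)\<close> is antitone in \<open>r\<close>, so it converges to its
  supremum as \<open>r\<close> tends to 0.\<close>
lemma essinf_tendsto_at_right_0:
  fixes f :: "real \<Rightarrow> ereal"
  assumes r: "0 < r" and m: "AE x\<in>{0<..<r} in lebesgue. m \<le> f x"
  shows "\<exists>L. ((\<lambda>r. essinf (lebesgue_on {0<..<r}) f) \<longlongrightarrow> L) (at_right 0) \<and> m \<le> L"
proof -
  define g where "g r = essinf (lebesgue_on {0<..<r}) f" for r :: real
  have g: "g r = Sup {c. AE x\<in>{0<..<r} in lebesgue. c \<le> f x}" for r
    unfolding g_def essinf_def by (subst AE_restrict_space_iff) auto
  have anti: "g r' \<le> g r" if "r \<le> r'" for r r'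
    unfolding g using that by (intro Sup_subset_mono) (auto elim!: eventually_mono)
  define L where "L = (SUP r\<in>{0<..}. g r)"
  have "(g \<longlongrightarrow> L) (at_right 0)"
  proof (rule order_tendstoI)
    fix a assume "a < L"
    then obtain r0 where r0: "0 < r0" "a < g r0" by (auto simp: L_def less_SUP_iff)
    then show "\<forall>\<^sub>F r in at_right 0. a < g r"
      using anti by (auto simp: eventually_at_right_field intro!: exI[of _ r0] elim: less_le_trans)
  next
    fix a assume "L < a"
    have "g r < a" if "0 < r" for r
      using that \<open>L < a\<close> unfolding L_def by (meson SUP_upper greaterThan_iff le_less_trans)
    then show "\<forall>\<^sub>F r in at_right 0. g r < a"
      by (auto simp: eventually_at_right_field intro!: exI[of _ 1])
  qed
  moreover have "m \<le> g r" unfolding g using m by (intro Sup_upper) auto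
  then have "m \<le> L" unfolding L_def using r by (auto intro: SUP_upper2)
  ultimately show ?thesis unfolding g_def by auto
qed

theorem theorem1p1:
  fixes lam \<alpha> k0 K0 :: real
  assumes "0 < lam" "lam < 1/2" "0 < \<alpha>" "0 < k0" "0 < K0"
  shows "\<exists>M m :: real. 0 < M \<and> 0 < m \<and>
    (\<forall>\<beta> K h.
       \<alpha> \<le> \<beta> \<longrightarrow> \<beta> < 1/2 \<longrightarrow> \<alpha> + \<beta> = 2 * lam \<longrightarrow>
       admissible_kernel lam \<alpha> \<beta> k0 K0 K \<longrightarrow>
       h \<in> borel_measurable (lebesgue_on {0<..}) \<longrightarrow>
       (\<forall>x>0. 0 < h x) \<longrightarrow>
       (AE x\<in>{0<..} in lebesgue. profile_equation lam K h x) \<longrightarrow>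
         (AE x\<in>{0<..} in lebesgue. h x \<le> M) \<and>
         (\<exists>L. ((\<lambda>r. essinf (lebesgue_on {0<..<r}) (\<lambda>x. ereal (h x))) \<longlongrightarrow> L) (at_right 0) \<and>
              ereal m \<le> L))"
proof (cases "\<alpha> \<le> 2 * lam - \<alpha> \<and> 2 * lam - \<alpha> < 1/2")
  case False
  \<comment> \<open>The exponent \<open>\<beta>\<close> is determined by \<open>\<lambda>\<close> and \<open>\<alpha>\<close>; here no admissible one exists.\<close>
  then show ?thesis by (intro exI[of _ 1] conjI allI impI) auto
next
  case True
  define \<beta> where "\<beta> = 2 * lam - \<alpha>"
  have exps: "\<alpha> \<le> \<beta>" "\<beta> < 1/2" using True by (auto simp: \<beta>_def)
  have B: "0 < Beta (1 - \<beta>) (1 - \<beta>)" "0 < Beta (1/2) (1 - \<beta>)" using exps by (auto simp: Beta_def Gamma_real_pos)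
  define u where "u = \<alpha> / (2 * K0 * Beta (1 - \<beta>) (1 - \<beta>))"
  define c where "c = u * (k0 / 2)"
  define C where "C = 8 / (3 * k0) * (2 * K0)"
  define D where "D = C * (40 * 2 powr \<alpha> / (c * \<alpha>))"
  define M where "M = D\<^sup>2 * Beta (1/2) (1 - \<beta>) * (40 / c) / (1/2 - \<beta>) + 1"
  have pos: "0 < c" "0 < C" using assms B by (auto simp: c_def C_def u_def)
  have M0: "0 \<le> D\<^sup>2 * Beta (1/2) (1 - \<beta>) * (40 / c) / (1/2 - \<beta>)"
    using pos B exps by (intro divide_nonneg_pos mult_nonneg_nonneg) auto
  then have M: "0 < M" by (simp add: M_def)
  obtain m where m: "0 < m" "\<And>H. bounded_profile \<alpha> \<beta> c C H M \<Longrightarrow>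
      \<exists>r>0. AE x in lborel. 0 < x \<longrightarrow> x < r \<longrightarrow> ennreal m \<le> H x"
    using essential_lower_bound[OF assms(3) exps pos M] by blast
  have "(AE x\<in>{0<..} in lebesgue. h x \<le> M) \<and>
         (\<exists>L. ((\<lambda>r. essinf (lebesgue_on {0<..<r}) (\<lambda>x. ereal (h x))) \<longlongrightarrow> L) (at_right 0) \<and>
              ereal m \<le> L)"
    if K: "admissible_kernel lam \<alpha> \<beta> k0 K0 K" and h: "h \<in> borel_measurable (lebesgue_on {0<..})"
      and h_pos: "\<forall>x>0. 0 < h x" and eq: "AE x\<in>{0<..} in lebesgue. profile_equation lam K h x" for K h
  proof -
    have "0 \<le> h_const lam K"
      using h_const_bounds(1)[OF K assms(4,5)] B assms by (auto elim!: order_trans[rotated])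
    then obtain H where H: "H \<in> borel_measurable borel" "AE x in lborel. 0 < x \<longrightarrow> H x = ennreal (h x)"
      "AE x in lborel. 0 < x \<longrightarrow> H x = ennreal (h_const lam K) * profile_operator lam K H x"
      using borel_representative[OF h eq h_pos] by blast
    interpret profile_bounds \<alpha> \<beta> c C H
      unfolding c_def C_def u_def
      by (rule profile_bounds_of_profile[OF K assms(4,5) h_pos H])
    have le: "AE x in lborel. 0 < x \<longrightarrow> H x \<le> ennreal M"
      using bounded
      by eventually_elim (auto simp: M_def D_def elim!: order_trans intro!: ennreal_leI)
    have "bounded_profile \<alpha> \<beta> c C H M"
      by unfold_locales (use M le in auto)
    then obtain r where r: "0 < r" "AE x in lborel. 0 < x \<longrightarrow> x < r \<longrightarrow> ennreal m \<le> H x"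
      using m by blast
    have "AE x\<in>{0<..} in lebesgue. h x \<le> M"
      unfolding AE_completion_iff using le H(2)
      by eventually_elim (use M in \<open>auto simp: ennreal_le_iff\<close>)
    moreover have "AE x\<in>{0<..<r} in lebesgue. ereal m \<le> ereal (h x)"
      unfolding AE_completion_iff using r(2) H(2)
      by eventually_elim (use h_pos in \<open>auto simp: ennreal_le_iff less_imp_le\<close>)
    then have "\<exists>L. ((\<lambda>r. essinf (lebesgue_on {0<..<r}) (\<lambda>x. ereal (h x))) \<longlongrightarrow> L) (at_right 0) \<and> ereal m \<le> L"
      by (rule essinf_tendsto_at_right_0[OF r(1)])
    ultimately show ?thesis by blast
  qed
  note main = this
  show ?thesis
  proof (rule exI[of _ M], rule exI[of _ m], rule conjI[OF M], rule conjI[OF m(1)], intro allI impI, goal_cases)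
    case (1 \<beta>' K h)
    then have "\<beta>' = \<beta>" by (simp add: \<beta>_def)
    with 1 show ?case by (intro main) auto
  qed
qed

end
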